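(* Let $(A,\delta,\gamma,\alpha)$ be a cocommutative Hom-Poisson coalgebra over $\mathbf{K}$ and let $(M,\Delta,\Gamma,\beta)$ be a Hom-Poisson comodule over $(A,\delta,\gamma,\alpha)$. Define $$\tilde\Delta=(\alpha^2\otimes \mathrm{Id}_M)\circ\Delta:M\to A\otimes M,\qquad \tilde\Gamma=(\alpha^2\otimes \mathrm{Id}_M)\circ\Gamma:M\to A\otimes M.$$ Then $\tilde\Delta$ and $\tilde\Gamma$ are structure maps of another Hom-Poisson comodule structure on $M$; that is, $(M,\tilde\Delta,\tilde\Gamma,\beta)$ is a Hom-Poisson comodule over $(A,\delta,\gamma,\alpha)$.
   Context: $\mathbf{K}$ is a field of characteristic $0$; linearity and $\otimes$ are over $\mathbf{K}$. $\tau$ denotes the flip $\tau(x\otimes y)=y\otimes x$, and $\sigma:A^{\otimes 3}\to A^{\otimes 3}$ is $\sigma(x_1\otimes x_2\otimes x_3)=x_3\otimes x_1\otimes x_2$. A Hom-coassociative coalgebra $(A,\delta,\alpha)$: a linear space $A$ with linear maps $\delta:A\to A\otimes A$, $\alpha:A\to A$ such that $\delta\circ\alpha=\alpha^{\otimes 2}\circ\delta$ and $(\alpha\otimes\delta)\circ\delta=(\delta\otimes\alpha)\circ\delta$; it is cocommutative if $\delta=\tau\circ\delta$. A Hom-Lie coalgebra $(A,\gamma,\alpha)$: linear maps $\gamma:A\to A\otimes A$, $\alpha:A\to A$ with $\gamma=-\tau\circ\gamma$, $\gamma\circ\alpha=\alpha^{\otimes 2}\circ\gamma$ and $(\mathrm{Id}+\sigma+\sigma^2)\circ(\alpha\otimes\gamma)\circ\gamma=0$.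 A cocommutative Hom-Poisson coalgebra $(A,\delta,\gamma,\alpha)$: $(A,\delta,\alpha)$ is a cocommutative Hom-coassociative coalgebra, $(A,\gamma,\alpha)$ is a Hom-Lie coalgebra, and $(\alpha\otimes\delta)\circ\gamma=(\gamma\otimes\alpha)\circ\delta+(\tau\otimes \mathrm{Id}_A)\circ(\alpha\otimes\gamma)\circ\delta$. A Hom-module is a pair $(M,\beta)$ of a linear space $M$ and a linear map $\beta:M\to M$. A comodule over the Hom-coassociative coalgebra $(A,\delta,\alpha)$ on $(M,\beta)$ is a linear map $\Delta:M\to A\otimes M$ with $\Delta\circ\beta=(\alpha\otimes\beta)\circ\Delta$ and $(\alpha\otimes\Delta)\circ\Delta=(\delta\otimes\beta)\circ\Delta$. A comodule over the Hom-Lie coalgebra $(A,\gamma,\alpha)$ on $(M,\beta)$ is a linear map $\Gamma:M\to A\otimes M$ with $\Gamma\circ\beta=(\alpha\otimes\beta)\circ\Gamma$ and $(\gamma\otimes\beta)\circ\Gamma=(\alpha\otimes\Gamma)\circ\Gamma-(\tau\otimes \mathrm{Id}_M)\circ(\alpha\otimes\Gamma)\circ\Gamma$. A Hom-Poisson comodule $(M,\Delta,\Gamma,\beta)$ over the cocommutative Hom-Poisson coalgebra $(A,\delta,\gamma,\alpha)$: $(M,\beta)$ is a Hom-module, $\Delta$ is a comodule structure over $(A,\delta,\alpha)$, $\Gamma$ is a comodule structure over $(A,\gamma,\alpha)$, and $(\alpha\otimes\Delta)\circ\Gamma=(\gamma\otimes\beta)\circ\Delta+(\tau\otimes \mathrm{Id}_M)\circ(\alpha\otimes\Gamma)\circ\Delta$,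 $(\delta\otimes\beta)\circ\Gamma=(\alpha\otimes\Gamma)\circ\Delta+(\tau\otimes \mathrm{Id}_M)\circ(\alpha\otimes\Gamma)\circ\Delta$. The maps $\Delta,\Gamma$ are called its structure maps. *)

theory Defs
  imports "Jordan_Normal_Form.Missing_VectorSpace" "HOL-Algebra.AbelCoset"
begin

section \<open>Tensor products of vector spaces\<close>

text \<open>
  The tensor product of \<open>M\<close> and \<open>N\<close> is the free vector space on the pairs \<open>(x, y)\<close> modulo the bilinearity relations.
  Vectors of the free space on \<open>S\<close> are the finitely supported functions \<open>S \<rightarrow> K\<close>.
\<close>

definition free_space :: "('k, 'r) ring_scheme \<Rightarrow> 's set \<Rightarrow> ('k, 's \<Rightarrow> 'k) module" where
  "free_space K S = (ring.func_space K S)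
     \<lparr>carrier := {u \<in> S \<rightarrow>\<^sub>E carrier K. finite {s \<in> S. u s \<noteq> \<zero>\<^bsub>K\<^esub>}}\<rparr>"

definition free_gen :: "('k, 'r) ring_scheme \<Rightarrow> 's set \<Rightarrow> 's \<Rightarrow> ('s \<Rightarrow> 'k)" where
  "free_gen K S s = (\<lambda>t\<in>S. if t = s then \<one>\<^bsub>K\<^esub> else \<zero>\<^bsub>K\<^esub>)"

text \<open>The fields \<open>mult\<close> and \<open>one\<close>, inherited by the record of modules from that of rings, play no role.\<close>

definition quotient_space ::
  "('k, 'r) ring_scheme \<Rightarrow> ('k, 'v, 'm) module_scheme \<Rightarrow> 'v set \<Rightarrow> ('k, 'v set) module" where
  "quotient_space K V W =
     \<lparr>carrier = a_rcosets\<^bsub>V\<^esub> W, mult = undefined, one = undefined, zero = W, add = set_add V,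
      smult = (\<lambda>c C. \<Union>v\<in>C. W +>\<^bsub>V\<^esub> (c \<odot>\<^bsub>V\<^esub> v))\<rparr>"

definition bilinear_relations ::
  "('k, 'r) ring_scheme \<Rightarrow> ('k, 'a, 'm) module_scheme \<Rightarrow> ('k, 'b, 'n) module_scheme \<Rightarrow> ('a \<times> 'b \<Rightarrow> 'k) set" where
  "bilinear_relations K M N =
    (let F = free_space K (carrier M \<times> carrier N);
         e = (\<lambda>x y. free_gen K (carrier M \<times> carrier N) (x, y))
     in {e (x \<oplus>\<^bsub>M\<^esub> x') y \<ominus>\<^bsub>F\<^esub> (e x y \<oplus>\<^bsub>F\<^esub> e x' y) | x x' y.
           x \<in> carrier M \<and> x' \<in> carrier M \<and> y \<in> carrier N}
      \<union> {e x (y \<oplus>\<^bsub>N\<^esub> y') \<ominus>\<^bsub>F\<^esub> (e x y \<oplus>\<^bsub>F\<^esub> e x y') | x y y'.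
           x \<in> carrier M \<and> y \<in> carrier N \<and> y' \<in> carrier N}
      \<union> {e (c \<odot>\<^bsub>M\<^esub> x) y \<ominus>\<^bsub>F\<^esub> c \<odot>\<^bsub>F\<^esub> e x y | c x y.
           c \<in> carrier K \<and> x \<in> carrier M \<and> y \<in> carrier N}
      \<union> {e x (c \<odot>\<^bsub>N\<^esub> y) \<ominus>\<^bsub>F\<^esub> c \<odot>\<^bsub>F\<^esub> e x y | c x y.
           c \<in> carrier K \<and> x \<in> carrier M \<and> y \<in> carrier N})"

definition tensor_ker ::
  "('k, 'r) ring_scheme \<Rightarrow> ('k, 'a, 'm) module_scheme \<Rightarrow> ('k, 'b, 'n) module_scheme \<Rightarrow> ('a \<times> 'b \<Rightarrow> 'k) set" where
  "tensor_ker K M N =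
     module.span K (free_space K (carrier M \<times> carrier N)) (bilinear_relations K M N)"

definition tensor_space ::
  "('k, 'r) ring_scheme \<Rightarrow> ('k, 'a, 'm) module_scheme \<Rightarrow> ('k, 'b, 'n) module_scheme
     \<Rightarrow> ('k, ('a \<times> 'b \<Rightarrow> 'k) set) module" where
  "tensor_space K M N =
     quotient_space K (free_space K (carrier M \<times> carrier N)) (tensor_ker K M N)"

definition tensor ::
  "('k, 'r) ring_scheme \<Rightarrow> ('k, 'a, 'm) module_scheme \<Rightarrow> ('k, 'b, 'n) module_scheme
     \<Rightarrow> 'a \<Rightarrow> 'b \<Rightarrow> ('a \<times> 'b \<Rightarrow> 'k) set" where
  "tensor K M N x y =
     tensor_ker K M N +>\<^bsub>free_space K (carrier M \<times> carrier N)\<^esub>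
       free_gen K (carrier M \<times> carrier N) (x, y)"

definition bilinear_map ::
  "('k, 'r) ring_scheme \<Rightarrow> ('k, 'a, 'm) module_scheme \<Rightarrow> ('k, 'b, 'n) module_scheme
     \<Rightarrow> ('k, 'c, 'p) module_scheme \<Rightarrow> ('a \<Rightarrow> 'b \<Rightarrow> 'c) \<Rightarrow> bool" where
  "bilinear_map K M N P f \<longleftrightarrow>
     (\<forall>x\<in>carrier M. linear_map K N P (f x)) \<and>
     (\<forall>y\<in>carrier N. linear_map K M P (\<lambda>x. f x y))"

lemma (in module) submodule_abelian_subgroup:
  assumes "LinearCombinations.submodule R W M"
  shows "abelian_subgroup W M"
proof -
  interpret W: LinearCombinations.submodule R W M by fact
  have inv: "\<ominus>\<^bsub>M\<^esub> x \<in> W" if "x \<in> W" for x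
    using that W.subset smult_minus_1[of x] W.smult_closed[of "\<ominus>\<^bsub>R\<^esub> \<one>\<^bsub>R\<^esub>" x] by (metis R.add.inv_closed R.one_closed subsetD)
  have "subgroup W (add_monoid M)"
    using W.subset inv by (intro M.add.subgroupI) (use W.zero_closed in \<open>auto simp: a_inv_def[symmetric] intro: W.m_closed simp del: W.zero_closed\<close>) 
  then show ?thesis
    by (intro abelian_subgroupI3 additive_subgroupI M.abelian_group_axioms)
qed

lemma quotient_smult:
  assumes "module K V" "LinearCombinations.submodule K W V" "c \<in> carrier K" "v \<in> carrier V"
  shows "c \<odot>\<^bsub>quotient_space K V W\<^esub> (W +>\<^bsub>V\<^esub> v) = W +>\<^bsub>V\<^esub> (c \<odot>\<^bsub>V\<^esub> v)"
proof -
  interpret module K V by fact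
  interpret W: LinearCombinations.submodule K W V by fact
  interpret Q: abelian_subgroup W V using submodule_abelian_subgroup assms by auto
  have eq: "W +>\<^bsub>V\<^esub> (c \<odot>\<^bsub>V\<^esub> u) = W +>\<^bsub>V\<^esub> (c \<odot>\<^bsub>V\<^esub> v)" if u: "u \<in> W +>\<^bsub>V\<^esub> v" for u
  proof -
    obtain w where w: "w \<in> W" "u = w \<oplus>\<^bsub>V\<^esub> v" using u unfolding a_r_coset_def r_coset_def by auto
    then have "c \<odot>\<^bsub>V\<^esub> u = c \<odot>\<^bsub>V\<^esub> w \<oplus>\<^bsub>V\<^esub> c \<odot>\<^bsub>V\<^esub> v" using assms W.subset smult_r_distr by auto
    then have "c \<odot>\<^bsub>V\<^esub> u \<in> W +>\<^bsub>V\<^esub> (c \<odot>\<^bsub>V\<^esub> v)" 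
      using w assms by (auto simp: a_r_coset_def')
    then show ?thesis
      by (rule M.a_repr_independence[OF _ smult_closed[OF assms(3,4)] Q.a_subgroup, symmetric])
  qed
  have "(\<Union>u\<in>W +>\<^bsub>V\<^esub> v. W +>\<^bsub>V\<^esub> (c \<odot>\<^bsub>V\<^esub> u)) = W +>\<^bsub>V\<^esub> (c \<odot>\<^bsub>V\<^esub> v)"
    by (intro UN_constant_eq[OF Q.a_rcos_self[OF assms(4)]] ballI eq)
  then show ?thesis by (simp only: quotient_space_def module.simps)
qed

lemma quotient_add:
  assumes "module K V" "LinearCombinations.submodule K W V" "u \<in> carrier V" "v \<in> carrier V"
  shows "(W +>\<^bsub>V\<^esub> u) \<oplus>\<^bsub>quotient_space K V W\<^esub> (W +>\<^bsub>V\<^esub> v) = W +>\<^bsub>V\<^esub> (u \<oplus>\<^bsub>V\<^esub> v)"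
proof -
  interpret module K V by fact
  interpret Q: abelian_subgroup W V using submodule_abelian_subgroup assms by auto
  show ?thesis unfolding quotient_space_def ring.simps by (rule Q.a_rcos_sum[OF assms(3,4)])
qed

lemma quotient_carrier:
  "carrier (quotient_space K V W) = (\<lambda>v. W +>\<^bsub>V\<^esub> v) ` carrier V"
  by (auto simp: quotient_space_def A_RCOSETS_def')

lemma quotient_zero:
  assumes "module K V" "LinearCombinations.submodule K W V"
  shows "\<zero>\<^bsub>quotient_space K V W\<^esub> = W +>\<^bsub>V\<^esub> \<zero>\<^bsub>V\<^esub>"
proof -
  interpret module K V by fact
  interpret W: LinearCombinations.submodule K W V by fact
  show ?thesis using W.subset by (auto simp: quotient_space_def)
qed

lemma quotient_module:
  assumes "module K V" "LinearCombinations.submodule K W V"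
  shows "module K (quotient_space K V W)"
proof -
  interpret module K V by fact
  have neg: "\<exists>u\<in>carrier V. v \<oplus>\<^bsub>V\<^esub> u = \<zero>\<^bsub>V\<^esub>" if "v \<in> carrier V" for v
    using that M.r_neg by auto
  have neg': "\<exists>u\<in>carrier V. W +>\<^bsub>V\<^esub> (v \<oplus>\<^bsub>V\<^esub> u) = W +>\<^bsub>V\<^esub> \<zero>\<^bsub>V\<^esub>" if "v \<in> carrier V" for v
    using neg[OF that] by force
  note q = quotient_carrier quotient_zero[OF assms] quotient_add[OF assms] quotient_smult[OF assms]
  show ?thesis
  proof (rule module_criteria, goal_cases)
    case 1 show ?case by (rule R.is_cring)
  next case 2 show ?case by (simp add: q)
  next case 3 show ?case by (auto simp: q)
  next case 4 show ?case using neg' by (auto simp: q)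
  next case 5 show ?case by (auto simp: q)
  next case 6 show ?case by (auto simp only: q M.a_comm elim!: imageE)
  next case 7 show ?case by (auto simp: q M.a_assoc)
  next case 8 show ?case by (auto simp: q)
  next case 9 show ?case by (auto simp: q smult_assoc1)
  next case 10 show ?case by (auto simp: q)
  next case 11 show ?case by (auto simp: q smult_l_distr)
  next case 12 show ?case by (auto simp: q smult_r_distr)
  qed
qed

lemma coset_hom:
  assumes "module K V" "LinearCombinations.submodule K W V"
  shows "(\<lambda>v. W +>\<^bsub>V\<^esub> v) \<in> module_hom K V (quotient_space K V W)"
  by (auto simp: module_hom_def quotient_carrier quotient_add[OF assms] quotient_smult[OF assms])

lemma quotient_induced:
  assumes "module K V" "LinearCombinations.submodule K W V" "mod_hom K V P g"
    and "\<And>w. w \<in> W \<Longrightarrow> g w = \<zero>\<^bsub>P\<^esub>"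
  obtains h where "mod_hom K (quotient_space K V W) P h" "\<And>v. v \<in> carrier V \<Longrightarrow> h (W +>\<^bsub>V\<^esub> v) = g v"
proof -
  interpret g: mod_hom K V P g by fact
  interpret W: LinearCombinations.submodule K W V by fact
  interpret Q: abelian_subgroup W V using module.submodule_abelian_subgroup assms by blast
  define h where "h C = g (SOME v. v \<in> C)" for C
  have h: "h (W +>\<^bsub>V\<^esub> v) = g v" if v: "v \<in> carrier V" for v
  proof -
    have "(SOME u. u \<in> W +>\<^bsub>V\<^esub> v) \<in> W +>\<^bsub>V\<^esub> v" using Q.a_rcos_self[OF v] by (rule someI)
    then obtain w where w: "w \<in> W" "(SOME u. u \<in> W +>\<^bsub>V\<^esub> v) = w \<oplus>\<^bsub>V\<^esub> v" unfolding a_r_coset_def r_coset_def by auto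
    have "g v \<in> carrier P" using g.f_im v by auto
    then show ?thesis using w assms(4) v W.subset g.f_add[of w v] by (auto simp: h_def)
  qed
  have "mod_hom K (quotient_space K V W) P h"
    apply (intro mod_hom.intro quotient_module assms g.N.module_axioms mod_hom_axioms.intro)
    using g.f_im by (auto simp: module_hom_def quotient_carrier quotient_add[OF assms(1,2)] quotient_smult[OF assms(1,2)] h)
  then show ?thesis using that h by auto
qed


lemma free_space_submodule:
  assumes "field K"
  shows "LinearCombinations.submodule K {u \<in> S \<rightarrow>\<^sub>E carrier K. finite {s \<in> S. u s \<noteq> \<zero>\<^bsub>K\<^esub>}} (ring.func_space K S)"
proof -
  interpret field K by fact
  have A: "finite {s \<in> S. v s \<oplus>\<^bsub>K\<^esub> w s \<noteq> \<zero>\<^bsub>K\<^esub>}" 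
    if "finite {s \<in> S. v s \<noteq> \<zero>\<^bsub>K\<^esub>}" "finite {s \<in> S. w s \<noteq> \<zero>\<^bsub>K\<^esub>}" for v w
    by (rule finite_subset[OF _ finite_UnI[OF that]]) auto
  have B: "finite {s \<in> S. c \<otimes>\<^bsub>K\<^esub> v s \<noteq> \<zero>\<^bsub>K\<^esub>}" 
    if "finite {s \<in> S. v s \<noteq> \<zero>\<^bsub>K\<^esub>}" "c \<in> carrier K" for v c
    by (rule finite_subset[OF _ that(1)]) (use that in auto)
  show ?thesis
    using func_space_is_module[of S]
    by (intro LinearCombinations.submodule.intro)
       (auto simp: func_space_def PiE_mem cong: conj_cong intro!: A B)
qed

lemma free_space_vectorspace:
  assumes "field K"
  shows "vectorspace K (free_space K S)"
proof -
  interpret field K by fact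
  show ?thesis unfolding vectorspace_def free_space_def
    using module.submodule_is_module[OF func_space_is_module free_space_submodule[OF assms]] assms by auto
qed

lemma free_space_simps:
  assumes "field K"
  shows "carrier (free_space K S) = {u \<in> S \<rightarrow>\<^sub>E carrier K. finite {s \<in> S. u s \<noteq> \<zero>\<^bsub>K\<^esub>}}"
    "u \<oplus>\<^bsub>free_space K S\<^esub> v = (\<lambda>s\<in>S. u s \<oplus>\<^bsub>K\<^esub> v s)"
    "\<zero>\<^bsub>free_space K S\<^esub> = (\<lambda>s\<in>S. \<zero>\<^bsub>K\<^esub>)"
    "c \<odot>\<^bsub>free_space K S\<^esub> u = (\<lambda>s\<in>S. c \<otimes>\<^bsub>K\<^esub> u s)"
proof -
  interpret field K by fact
  show "carrier (free_space K S) = {u \<in> S \<rightarrow>\<^sub>E carrier K. finite {s \<in> S. u s \<noteq> \<zero>\<^bsub>K\<^esub>}}"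
    "u \<oplus>\<^bsub>free_space K S\<^esub> v = (\<lambda>s\<in>S. u s \<oplus>\<^bsub>K\<^esub> v s)"
    "\<zero>\<^bsub>free_space K S\<^esub> = (\<lambda>s\<in>S. \<zero>\<^bsub>K\<^esub>)"
    "c \<odot>\<^bsub>free_space K S\<^esub> u = (\<lambda>s\<in>S. c \<otimes>\<^bsub>K\<^esub> u s)"
    by (auto simp: free_space_def func_space_def)
qed

lemma free_gen_carrier:
  assumes "field K" "s \<in> S"
  shows "free_gen K S s \<in> carrier (free_space K S)"
proof -
  interpret field K by fact
  have "finite {t \<in> S. free_gen K S s t \<noteq> \<zero>\<^bsub>K\<^esub>}"
    by (rule finite_subset[of _ "{s}"]) (auto simp: free_gen_def split: if_splits)
  moreover have "free_gen K S s \<in> S \<rightarrow>\<^sub>E carrier K"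
    unfolding free_gen_def by (rule restrict_PiE_iff[THEN iffD2]) simp
  ultimately show ?thesis unfolding free_space_simps(1)[OF assms(1)] mem_Collect_eq by blast
qed

lemma free_space_induct:
  assumes K: "field K" and u: "u \<in> carrier (free_space K S)"
    and zero: "P \<zero>\<^bsub>free_space K S\<^esub>"
    and step: "\<And>c s v. c \<in> carrier K \<Longrightarrow> s \<in> S \<Longrightarrow> v \<in> carrier (free_space K S) \<Longrightarrow> P v \<Longrightarrow>
       P (c \<odot>\<^bsub>free_space K S\<^esub> free_gen K S s \<oplus>\<^bsub>free_space K S\<^esub> v)"
  shows "P u"
proof -
  interpret field K by fact
  note fs = free_space_simps[OF K]
  have "\<forall>u. u \<in> carrier (free_space K S) \<and> {s\<in>S. u s \<noteq> \<zero>\<^bsub>K\<^esub>} \<subseteq> T \<longrightarrow> P u" if "finite T" for T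
    using that
  proof (induct T)
    case empty
    have "u = \<zero>\<^bsub>free_space K S\<^esub>" if "u \<in> carrier (free_space K S)" "{s\<in>S. u s \<noteq> \<zero>\<^bsub>K\<^esub>} \<subseteq> {}" for u
    proof
      fix s
      have "u \<in> S \<rightarrow>\<^sub>E carrier K" using that(1) unfolding fs(1) by blast
      then show "u s = \<zero>\<^bsub>free_space K S\<^esub> s"
        unfolding fs(3) using that(2) by (cases "s \<in> S") (auto dest: PiE_arb)
    qed
    then show ?case using zero by blast
  next
    case (insert t T)
    show ?case
    proof (intro allI impI, elim conjE)
      fix u assume u: "u \<in> carrier (free_space K S)" "{s\<in>S. u s \<noteq> \<zero>\<^bsub>K\<^esub>} \<subseteq> insert t T"
      show "P u"
      proof (cases "t \<in> S")
        case True
        define v where "v = u(t := \<zero>\<^bsub>K\<^esub>)"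
        have vfin: "finite {s \<in> S. v s \<noteq> \<zero>\<^bsub>K\<^esub>}"
          by (rule finite_subset[of _ "{s \<in> S. u s \<noteq> \<zero>\<^bsub>K\<^esub>}"]) (use u in \<open>auto simp: v_def fs\<close>)
        have uP: "u \<in> S \<rightarrow>\<^sub>E carrier K" using u(1) unfolding fs(1) by blast
        have v: "v \<in> carrier (free_space K S)"
          using vfin uP True unfolding fs(1) by (auto simp: v_def PiE_iff extensional_def)
        have "{s\<in>S. v s \<noteq> \<zero>\<^bsub>K\<^esub>} \<subseteq> T" using u by (auto simp: v_def)
        then have "P v" using insert v by auto
        moreover have "u t \<in> carrier K" using u True by (auto simp: fs)
        moreover have "u = u t \<odot>\<^bsub>free_space K S\<^esub> free_gen K S t \<oplus>\<^bsub>free_space K S\<^esub> v"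
        proof
          fix s show "u s = (u t \<odot>\<^bsub>free_space K S\<^esub> free_gen K S t \<oplus>\<^bsub>free_space K S\<^esub> v) s"
          proof (cases "s \<in> S")
            case sS: True
            then have "u s \<in> carrier K" "u t \<in> carrier K" using uP True by (blast intro: PiE_mem)+
            then show ?thesis using sS by (simp add: fs(2,4) free_gen_def v_def)
          next
            case False
            then show ?thesis using PiE_arb[OF uP False] by (simp add: fs(2))
          qed
        qed
        ultimately show ?thesis using step[OF _ True v] by metis
      next
        case False
        then show ?thesis using insert u by auto
      qed
    qed
  qed
  from this[of "{s\<in>S. u s \<noteq> \<zero>\<^bsub>K\<^esub>}"] show ?thesis using u by (auto simp: fs)
qed

lemma free_extend:
  assumes K: "field K" and P: "module K P" and f: "f \<in> S \<rightarrow> carrier P"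
  obtains g where "mod_hom K (free_space K S) P g" "\<And>s. s \<in> S \<Longrightarrow> g (free_gen K S s) = f s"
proof -
  interpret K: field K by fact
  interpret P: module K P by fact
  note fs = free_space_simps[OF K]
  let ?F = "free_space K S"
  define g where "g u = (\<Oplus>\<^bsub>P\<^esub>s\<in>{s\<in>S. u s \<noteq> \<zero>\<^bsub>K\<^esub>}. u s \<odot>\<^bsub>P\<^esub> f s)" for u
  have big: "g u = (\<Oplus>\<^bsub>P\<^esub>s\<in>T. u s \<odot>\<^bsub>P\<^esub> f s)" 
    if "u \<in> carrier ?F" "finite T" "{s\<in>S. u s \<noteq> \<zero>\<^bsub>K\<^esub>} \<subseteq> T" "T \<subseteq> S" for u T
    unfolding g_def using that f
    by (intro P.add.finprod_mono_neutral_cong_left) (auto simp: fs Pi_iff PiE_iff)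
  have clos: "g u \<in> carrier P" if "u \<in> carrier ?F" for u
    unfolding g_def using that f by (intro P.finsum_closed) (auto simp: fs Pi_iff PiE_iff)
  interpret F: vectorspace K ?F by (rule free_space_vectorspace[OF K])
  have add: "g (u \<oplus>\<^bsub>?F\<^esub> v) = g u \<oplus>\<^bsub>P\<^esub> g v" if uv: "u \<in> carrier ?F" "v \<in> carrier ?F" for u v
  proof -
    let ?T = "{s\<in>S. u s \<noteq> \<zero>\<^bsub>K\<^esub>} \<union> {s\<in>S. v s \<noteq> \<zero>\<^bsub>K\<^esub>}"
    have T: "finite ?T" "?T \<subseteq> S" using uv by (auto simp: fs)
    have "g (u \<oplus>\<^bsub>?F\<^esub> v) = (\<Oplus>\<^bsub>P\<^esub>s\<in>?T. (u \<oplus>\<^bsub>?F\<^esub> v) s \<odot>\<^bsub>P\<^esub> f s)"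
      using uv T by (intro big F.M.a_closed) (auto simp: fs(2))
    also have "\<dots> = (\<Oplus>\<^bsub>P\<^esub>s\<in>?T. u s \<odot>\<^bsub>P\<^esub> f s \<oplus>\<^bsub>P\<^esub> v s \<odot>\<^bsub>P\<^esub> f s)"
      using uv f by (intro P.finsum_cong') (auto simp: fs P.smult_l_distr Pi_iff PiE_iff)
    also have "\<dots> = (\<Oplus>\<^bsub>P\<^esub>s\<in>?T. u s \<odot>\<^bsub>P\<^esub> f s) \<oplus>\<^bsub>P\<^esub> (\<Oplus>\<^bsub>P\<^esub>s\<in>?T. v s \<odot>\<^bsub>P\<^esub> f s)"
      using uv f by (intro P.finsum_addf) (auto simp: fs Pi_iff PiE_iff)
    also have "\<dots> = g u \<oplus>\<^bsub>P\<^esub> g v" using big[OF uv(1) T(1) _ T(2)] big[OF uv(2) T(1) _ T(2)] by auto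
    finally show ?thesis .
  qed
  have smult: "g (c \<odot>\<^bsub>?F\<^esub> u) = c \<odot>\<^bsub>P\<^esub> g u" if u: "u \<in> carrier ?F" "c \<in> carrier K" for u c
  proof -
    let ?T = "{s\<in>S. u s \<noteq> \<zero>\<^bsub>K\<^esub>}"
    have T: "finite ?T" "?T \<subseteq> S" using u by (auto simp: fs)
    have "g (c \<odot>\<^bsub>?F\<^esub> u) = (\<Oplus>\<^bsub>P\<^esub>s\<in>?T. (c \<odot>\<^bsub>?F\<^esub> u) s \<odot>\<^bsub>P\<^esub> f s)"
      using u T by (intro big F.smult_closed) (auto simp: fs(4))
    also have "\<dots> = (\<Oplus>\<^bsub>P\<^esub>s\<in>?T. c \<odot>\<^bsub>P\<^esub> (u s \<odot>\<^bsub>P\<^esub> f s))"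
      using u f by (intro P.finsum_cong') (auto simp: fs P.smult_assoc1 Pi_iff PiE_iff)
    also have "\<dots> = c \<odot>\<^bsub>P\<^esub> g u" unfolding g_def
      using u f by (intro P.finsum_smult[symmetric]) (auto simp: fs Pi_iff PiE_iff)
    finally show ?thesis .
  qed
  have "g (free_gen K S s) = f s" if s: "s \<in> S" for s
  proof -
    have "g (free_gen K S s) = (\<Oplus>\<^bsub>P\<^esub>t\<in>{s}. free_gen K S s t \<odot>\<^bsub>P\<^esub> f t)"
      using s by (intro big free_gen_carrier K) (auto simp: free_gen_def)
    also have "\<dots> = f s" using s f by (auto simp: free_gen_def Pi_iff)
    finally show ?thesis .
  qed
  moreover have "mod_hom K ?F P g"
    by (intro mod_hom.intro F.module_axioms P mod_hom_axioms.intro) (auto simp: module_hom_def clos add smult)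
  ultimately show ?thesis using that by auto
qed


lemma bilinear_relations_carrier:
  assumes "vectorspace K M" "vectorspace K N"
  shows "bilinear_relations K M N \<subseteq> carrier (free_space K (carrier M \<times> carrier N))"
proof -
  interpret M: vectorspace K M by fact
  interpret N: vectorspace K N by fact
  interpret F: vectorspace K "free_space K (carrier M \<times> carrier N)"
    by (rule free_space_vectorspace) (rule M.field_axioms)
  note [intro!, simp] = free_gen_carrier[OF M.field_axioms] F.M.minus_closed
  show ?thesis unfolding bilinear_relations_def Let_def by auto
qed

lemma tensor_ker_submodule:
  assumes "vectorspace K M" "vectorspace K N"
  shows "LinearCombinations.submodule K (tensor_ker K M N) (free_space K (carrier M \<times> carrier N))"
proof -
  interpret M: vectorspace K M by fact
  interpret F: vectorspace K "free_space K (carrier M \<times> carrier N)"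
    by (rule free_space_vectorspace) (rule M.field_axioms)
  show ?thesis unfolding tensor_ker_def
    using bilinear_relations_carrier[OF assms] by (rule F.span_is_submodule)
qed

lemma tensor_space_vectorspace:
  assumes "vectorspace K M" "vectorspace K N"
  shows "vectorspace K (tensor_space K M N)"
proof -
  interpret M: vectorspace K M by fact
  interpret F: vectorspace K "free_space K (carrier M \<times> carrier N)"
    by (rule free_space_vectorspace) (rule M.field_axioms)
  show ?thesis unfolding tensor_space_def vectorspace_def
    using quotient_module[OF F.module_axioms tensor_ker_submodule[OF assms]] M.field_axioms by auto
qed

lemma tensor_closed:
  assumes "vectorspace K M" "vectorspace K N" "x \<in> carrier M" "y \<in> carrier N"
  shows "tensor K M N x y \<in> carrier (tensor_space K M N)"
proof -
  interpret M: vectorspace K M by fact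
  show ?thesis using assms unfolding tensor_space_def tensor_def quotient_carrier
    by (intro imageI free_gen_carrier M.field_axioms) auto
qed

lemma tensor_bilinear:
  assumes "vectorspace K M" "vectorspace K N"
  shows "bilinear_map K M N (tensor_space K M N) (tensor K M N)"
proof -
  interpret M: vectorspace K M by fact
  interpret N: vectorspace K N by fact
  let ?F = "free_space K (carrier M \<times> carrier N)"
  let ?W = "tensor_ker K M N"
  let ?e = "\<lambda>x y. free_gen K (carrier M \<times> carrier N) (x, y)"
  interpret F: vectorspace K ?F
    by (rule free_space_vectorspace) (rule M.field_axioms)
  have W: "LinearCombinations.submodule K ?W ?F" by (rule tensor_ker_submodule[OF assms])
  interpret T: vectorspace K "tensor_space K M N" by (rule tensor_space_vectorspace[OF assms])
  interpret Q: abelian_subgroup ?W ?F using F.submodule_abelian_subgroup W by blast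
  have sub: "bilinear_relations K M N \<subseteq> ?W" unfolding tensor_ker_def
    using bilinear_relations_carrier[OF assms] by (rule F.in_own_span)
  have eq: "?W +>\<^bsub>?F\<^esub> u = ?W +>\<^bsub>?F\<^esub> v" if "u \<in> carrier ?F" "v \<in> carrier ?F" "u \<ominus>\<^bsub>?F\<^esub> v \<in> bilinear_relations K M N" for u v
  proof -
    have "u = (u \<ominus>\<^bsub>?F\<^esub> v) \<oplus>\<^bsub>?F\<^esub> v" using that by (simp add: a_minus_def F.M.a_assoc F.M.l_neg)
    then have "u \<in> ?W +>\<^bsub>?F\<^esub> v" using that sub unfolding a_r_coset_def r_coset_def by auto
    then show ?thesis using that Q.a_subgroup F.M.a_repr_independence by metis
  qed
  have rel: "?e (x \<oplus>\<^bsub>M\<^esub> x') y \<ominus>\<^bsub>?F\<^esub> (?e x y \<oplus>\<^bsub>?F\<^esub> ?e x' y) \<in> bilinear_relations K M N"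
      "?e x (y \<oplus>\<^bsub>N\<^esub> y') \<ominus>\<^bsub>?F\<^esub> (?e x y \<oplus>\<^bsub>?F\<^esub> ?e x y') \<in> bilinear_relations K M N"
      "?e (c \<odot>\<^bsub>M\<^esub> x) y \<ominus>\<^bsub>?F\<^esub> c \<odot>\<^bsub>?F\<^esub> ?e x y \<in> bilinear_relations K M N"
      "?e x (c \<odot>\<^bsub>N\<^esub> y) \<ominus>\<^bsub>?F\<^esub> c \<odot>\<^bsub>?F\<^esub> ?e x y \<in> bilinear_relations K M N"
    if "x \<in> carrier M" "x' \<in> carrier M" "y \<in> carrier N" "y' \<in> carrier N" "c \<in> carrier K" for x x' y y' c
    using that unfolding bilinear_relations_def Let_def by blast+
  have g: "?e x y \<in> carrier ?F" if "x \<in> carrier M" "y \<in> carrier N" for x y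
    using that by (intro free_gen_carrier M.field_axioms) auto
  have add: "?W +>\<^bsub>?F\<^esub> w = (?W +>\<^bsub>?F\<^esub> u) \<oplus>\<^bsub>tensor_space K M N\<^esub> (?W +>\<^bsub>?F\<^esub> v)"
    if "u \<in> carrier ?F" "v \<in> carrier ?F" "w \<in> carrier ?F" "w \<ominus>\<^bsub>?F\<^esub> (u \<oplus>\<^bsub>?F\<^esub> v) \<in> bilinear_relations K M N" for u v w
    unfolding tensor_space_def quotient_add[OF F.module_axioms W that(1,2)]
    by (rule eq) (use that in auto)
  have smult: "?W +>\<^bsub>?F\<^esub> w = c \<odot>\<^bsub>tensor_space K M N\<^esub> (?W +>\<^bsub>?F\<^esub> u)"
    if "c \<in> carrier K" "u \<in> carrier ?F" "w \<in> carrier ?F" "w \<ominus>\<^bsub>?F\<^esub> c \<odot>\<^bsub>?F\<^esub> u \<in> bilinear_relations K M N" for c u w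
    unfolding tensor_space_def quotient_smult[OF F.module_axioms W that(1,2)]
    by (rule eq) (use that in auto)
  have t: "tensor K M N (x \<oplus>\<^bsub>M\<^esub> x') y = tensor K M N x y \<oplus>\<^bsub>tensor_space K M N\<^esub> tensor K M N x' y"
      "tensor K M N x (y \<oplus>\<^bsub>N\<^esub> y') = tensor K M N x y \<oplus>\<^bsub>tensor_space K M N\<^esub> tensor K M N x y'"
      "tensor K M N (c \<odot>\<^bsub>M\<^esub> x) y = c \<odot>\<^bsub>tensor_space K M N\<^esub> tensor K M N x y"
      "tensor K M N x (c \<odot>\<^bsub>N\<^esub> y) = c \<odot>\<^bsub>tensor_space K M N\<^esub> tensor K M N x y"
    if x: "x \<in> carrier M" "x' \<in> carrier M" "y \<in> carrier N" "y' \<in> carrier N" "c \<in> carrier K" for x x' y y' c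
    unfolding tensor_def
       apply (rule add[OF g g g rel(1)]; (use x in simp))
      apply (rule add[OF g g g rel(2)]; (use x in simp))
     apply (rule smult[OF _ g g rel(3)]; (use x in simp))
    apply (rule smult[OF _ g g rel(4)]; (use x in simp))
    done
  note cl = tensor_closed[OF assms]
  show ?thesis unfolding bilinear_map_def
  proof (intro conjI ballI)
    fix x assume x: "x \<in> carrier M"
    have "tensor K M N x \<in> module_hom K N (tensor_space K M N)"
      unfolding module_hom_def mem_Collect_eq
    proof (intro conjI allI impI funcsetI; (elim conjE)?)
      fix y y' c assume y: "y \<in> carrier N"
      show "tensor K M N x y \<in> carrier (tensor_space K M N)" by (rule cl[OF x y])
      show "tensor K M N x (y \<oplus>\<^bsub>N\<^esub> y') = tensor K M N x y \<oplus>\<^bsub>tensor_space K M N\<^esub> tensor K M N x y'"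
        if "y' \<in> carrier N" by (rule t(2)[OF x x y that M.R.zero_closed])
      show "tensor K M N x (c \<odot>\<^bsub>N\<^esub> y) = c \<odot>\<^bsub>tensor_space K M N\<^esub> tensor K M N x y"
        if "c \<in> carrier K" by (rule t(4)[OF x x y y that])
    qed
    then show "linear_map K N (tensor_space K M N) (tensor K M N x)"
      by (intro linear_map.intro mod_hom.intro mod_hom_axioms.intro N.vectorspace_axioms
          T.vectorspace_axioms N.module_axioms T.module_axioms)
  next
    fix y assume y: "y \<in> carrier N"
    have "(\<lambda>x. tensor K M N x y) \<in> module_hom K M (tensor_space K M N)"
      unfolding module_hom_def mem_Collect_eq
    proof (intro conjI allI impI funcsetI; (elim conjE)?)
      fix x x' c assume x: "x \<in> carrier M"
      show "tensor K M N x y \<in> carrier (tensor_space K M N)" by (rule cl[OF x y])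
      show "tensor K M N (x \<oplus>\<^bsub>M\<^esub> x') y = tensor K M N x y \<oplus>\<^bsub>tensor_space K M N\<^esub> tensor K M N x' y"
        if "x' \<in> carrier M" by (rule t(1)[OF x that y y M.R.zero_closed])
      show "tensor K M N (c \<odot>\<^bsub>M\<^esub> x) y = c \<odot>\<^bsub>tensor_space K M N\<^esub> tensor K M N x y"
        if "c \<in> carrier K" by (rule t(3)[OF x x y y that])
    qed
    then show "linear_map K M (tensor_space K M N) (\<lambda>x. tensor K M N x y)"
      by (intro linear_map.intro mod_hom.intro mod_hom_axioms.intro M.vectorspace_axioms
          T.vectorspace_axioms M.module_axioms T.module_axioms)
  qed
qed

lemma tensor_unique:
  assumes M: "vectorspace K M" and N: "vectorspace K N"
    and g: "linear_map K (tensor_space K M N) P g" and h: "linear_map K (tensor_space K M N) P h"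
    and eq: "\<And>x y. x \<in> carrier M \<Longrightarrow> y \<in> carrier N \<Longrightarrow> g (tensor K M N x y) = h (tensor K M N x y)"
    and t: "t \<in> carrier (tensor_space K M N)"
  shows "g t = h t"
proof -
  interpret M: vectorspace K M by fact
  interpret T: vectorspace K "tensor_space K M N" by (rule tensor_space_vectorspace[OF M N])
  have gm: "mod_hom K (tensor_space K M N) P g" and hm: "mod_hom K (tensor_space K M N) P h"
    using g h by (simp_all only: linear_map_def)
  let ?F = "free_space K (carrier M \<times> carrier N)"
  let ?W = "tensor_ker K M N"
  interpret F: vectorspace K ?F by (rule free_space_vectorspace) (rule M.field_axioms)
  have W: "LinearCombinations.submodule K ?W ?F" by (rule tensor_ker_submodule[OF M N])
  let ?q = "\<lambda>v. ?W +>\<^bsub>?F\<^esub> v"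
  have q: "?q \<in> module_hom K ?F (tensor_space K M N)"
    unfolding tensor_space_def by (rule coset_hom[OF F.module_axioms W])
  have qc: "?q v \<in> carrier (tensor_space K M N)" if "v \<in> carrier ?F" for v
    using module_hom_closed[OF q] that by (rule funcset_mem)
  obtain u where u: "u \<in> carrier ?F" "t = ?q u"
    using t unfolding tensor_space_def quotient_carrier by blast
  have "g (?q u) = h (?q u)"
  proof (rule free_space_induct[OF M.field_axioms u(1), where P="\<lambda>u. g (?q u) = h (?q u)"])
    have "?q \<zero>\<^bsub>?F\<^esub> = \<zero>\<^bsub>tensor_space K M N\<^esub>"
      unfolding tensor_space_def quotient_zero[OF F.module_axioms W] ..
    then show "g (?q \<zero>\<^bsub>?F\<^esub>) = h (?q \<zero>\<^bsub>?F\<^esub>)"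
      by (simp only: mod_hom.f0_is_0[OF gm] mod_hom.f0_is_0[OF hm])
  next
    fix c s v
    assume c: "c \<in> carrier K" and s: "s \<in> carrier M \<times> carrier N" and v: "v \<in> carrier ?F"
      and IH: "g (?q v) = h (?q v)"
    let ?s = "free_gen K (carrier M \<times> carrier N) s"
    have fs: "?s \<in> carrier ?F" by (rule free_gen_carrier[OF M.field_axioms s])
    have cs: "c \<odot>\<^bsub>?F\<^esub> ?s \<in> carrier ?F" by (rule F.smult_closed[OF c fs])
    obtain x y where xy: "s = (x, y)" "x \<in> carrier M" "y \<in> carrier N" using s by (rule SigmaE)
    have "?q ?s = tensor K M N x y" unfolding tensor_def xy(1) ..
    then have gs: "g (?q ?s) = h (?q ?s)" by (rule ssubst) (rule eq[OF xy(2,3)])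
    have k: "k (?q (c \<odot>\<^bsub>?F\<^esub> ?s \<oplus>\<^bsub>?F\<^esub> v)) = c \<odot>\<^bsub>P\<^esub> k (?q ?s) \<oplus>\<^bsub>P\<^esub> k (?q v)"
      if k: "k \<in> module_hom K (tensor_space K M N) P" for k
    proof -
      have "?q (c \<odot>\<^bsub>?F\<^esub> ?s \<oplus>\<^bsub>?F\<^esub> v) = c \<odot>\<^bsub>tensor_space K M N\<^esub> ?q ?s \<oplus>\<^bsub>tensor_space K M N\<^esub> ?q v"
        by (rule trans[OF module_hom_add[OF q cs v]])
           (rule arg_cong[OF module_hom_smult[OF q c fs], of "\<lambda>t. t \<oplus>\<^bsub>tensor_space K M N\<^esub> ?q v"])
      then have "k (?q (c \<odot>\<^bsub>?F\<^esub> ?s \<oplus>\<^bsub>?F\<^esub> v)) =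
          k (c \<odot>\<^bsub>tensor_space K M N\<^esub> ?q ?s \<oplus>\<^bsub>tensor_space K M N\<^esub> ?q v)" by (rule arg_cong)
      also have "\<dots> = k (c \<odot>\<^bsub>tensor_space K M N\<^esub> ?q ?s) \<oplus>\<^bsub>P\<^esub> k (?q v)"
        by (rule module_hom_add[OF k T.smult_closed[OF c qc[OF fs]] qc[OF v]])
      also have "k (c \<odot>\<^bsub>tensor_space K M N\<^esub> ?q ?s) = c \<odot>\<^bsub>P\<^esub> k (?q ?s)"
        by (rule module_hom_smult[OF k c qc[OF fs]])
      finally show ?thesis .
    qed
    show "g (?q (c \<odot>\<^bsub>?F\<^esub> ?s \<oplus>\<^bsub>?F\<^esub> v)) = h (?q (c \<odot>\<^bsub>?F\<^esub> ?s \<oplus>\<^bsub>?F\<^esub> v))"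
      unfolding k[OF mod_hom.f_hom[OF gm]] k[OF mod_hom.f_hom[OF hm]] gs IH ..
  qed
  then show ?thesis unfolding u(2) .
qed

theorem tensor_universal:
  assumes M: "vectorspace K M" and N: "vectorspace K N" and P: "vectorspace K P"
    and f: "bilinear_map K M N P f"
  shows "\<exists>!h. h \<in> extensional (carrier (tensor_space K M N)) \<and>
             linear_map K (tensor_space K M N) P h \<and>
             (\<forall>x\<in>carrier M. \<forall>y\<in>carrier N. h (tensor K M N x y) = f x y)"
proof -
  interpret M: vectorspace K M by fact
  interpret N: vectorspace K N by fact
  interpret P: vectorspace K P by fact
  let ?F = "free_space K (carrier M \<times> carrier N)"
  let ?W = "tensor_ker K M N"
  let ?e = "\<lambda>x y. free_gen K (carrier M \<times> carrier N) (x, y)"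
  let ?T = "tensor_space K M N"
  interpret F: vectorspace K ?F by (rule free_space_vectorspace) (rule M.field_axioms)
  interpret T: vectorspace K ?T by (rule tensor_space_vectorspace[OF M N])
  have W: "LinearCombinations.submodule K ?W ?F" by (rule tensor_ker_submodule[OF M N])
  have f1: "linear_map K N P (f x)" if "x \<in> carrier M" for x using f that by (auto simp: bilinear_map_def)
  have f2: "linear_map K M P (\<lambda>x. f x y)" if "y \<in> carrier N" for y using f that by (auto simp: bilinear_map_def)
  have fc: "f x y \<in> carrier P" if "x \<in> carrier M" "y \<in> carrier N" for x y
    using f1[OF that(1)] that unfolding linear_map_def mod_hom_def mod_hom_axioms_def module_hom_def by auto
  have "case_prod f \<in> carrier M \<times> carrier N \<rightarrow> carrier P" using fc by auto
  from free_extend[OF M.field_axioms P.module_axioms this]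
  obtain g where g: "mod_hom K ?F P g" and ge: "\<And>s. s \<in> carrier M \<times> carrier N \<Longrightarrow> g (free_gen K (carrier M \<times> carrier N) s) = case_prod f s"
    by blast
  interpret g: mod_hom K ?F P g by fact
  note [intro!, simp] = free_gen_carrier[OF M.field_axioms]
  have ge': "g (?e x y) = f x y" if "x \<in> carrier M" "y \<in> carrier N" for x y using ge that by auto
  have gc: "g u \<in> carrier P" if "u \<in> carrier ?F" for u
    using module_hom_closed[OF g.f_hom] that by auto
  have minus: "g (u \<ominus>\<^bsub>?F\<^esub> v) = \<zero>\<^bsub>P\<^esub>" if "u \<in> carrier ?F" "v \<in> carrier ?F" "g u = g v" for u v
  proof -
    have "g (u \<ominus>\<^bsub>?F\<^esub> v) \<oplus>\<^bsub>P\<^esub> g v = g (u \<ominus>\<^bsub>?F\<^esub> v \<oplus>\<^bsub>?F\<^esub> v)" using that by (intro g.f_add[symmetric]) auto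
    also have "u \<ominus>\<^bsub>?F\<^esub> v \<oplus>\<^bsub>?F\<^esub> v = u" using that by (simp add: a_minus_def F.M.a_assoc F.M.l_neg)
    finally have *: "g (u \<ominus>\<^bsub>?F\<^esub> v) \<oplus>\<^bsub>P\<^esub> g v = \<zero>\<^bsub>P\<^esub> \<oplus>\<^bsub>P\<^esub> g v"
      using that gc by simp
    show ?thesis
      using P.M.add.right_cancel[of "g v" "g (u \<ominus>\<^bsub>?F\<^esub> v)" "\<zero>\<^bsub>P\<^esub>"] gc * that by simp
  qed
  have rel: "bilinear_relations K M N \<subseteq> g.ker"
  proof
    fix w assume w: "w \<in> bilinear_relations K M N"
    then have "w \<in> carrier ?F" using bilinear_relations_carrier[OF M N] by auto
    moreover have "g w = \<zero>\<^bsub>P\<^esub>"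
      using w unfolding bilinear_relations_def Let_def
      apply (elim UnE CollectE exE conjE; hypsubst)
         apply (rule minus; (simp add: g.f_add ge' linear_map.T_add[OF f2])?)
        apply (rule minus; (simp add: g.f_add ge' linear_map.T_add[OF f1])?)
       apply (rule minus; (simp add: g.f_smult ge' linear_map.T_smult[OF f2])?)
      apply (rule minus; (simp add: g.f_smult ge' linear_map.T_smult[OF f1])?)
      done
    ultimately show "w \<in> g.ker" by (auto simp: g.ker_def)
  qed
  have "?W \<subseteq> g.ker" unfolding tensor_ker_def
    using rel g.ker_is_submodule by (rule F.span_is_subset)
  then have "\<And>w. w \<in> ?W \<Longrightarrow> g w = \<zero>\<^bsub>P\<^esub>" by (auto simp: g.ker_def)
  from quotient_induced[OF F.module_axioms W g this]
  obtain h0 where h0: "mod_hom K ?T P h0" "\<And>v. v \<in> carrier ?F \<Longrightarrow> h0 (?W +>\<^bsub>?F\<^esub> v) = g v"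
    unfolding tensor_space_def by blast
  define h where "h = restrict h0 (carrier ?T)"
  have lin: "linear_map K ?T P h"
    using h0(1) T.vectorspace_axioms P
    by (auto simp: linear_map_def mod_hom_def mod_hom_axioms_def module_hom_def h_def)
  have hf: "h (tensor K M N x y) = f x y" if "x \<in> carrier M" "y \<in> carrier N" for x y
    using that tensor_closed[OF M N that] h0(2)[of "?e x y"] ge' by (auto simp: h_def tensor_def)
  have hext: "h \<in> extensional (carrier ?T)" by (simp add: h_def)
  show ?thesis
  proof (rule ex1I[of _ h])
    show "h \<in> extensional (carrier ?T) \<and> linear_map K ?T P h \<and>
             (\<forall>x\<in>carrier M. \<forall>y\<in>carrier N. h (tensor K M N x y) = f x y)"
      using lin hf hext by blast
    fix k assume k: "k \<in> extensional (carrier ?T) \<and> linear_map K ?T P k \<and>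
             (\<forall>x\<in>carrier M. \<forall>y\<in>carrier N. k (tensor K M N x y) = f x y)"
    show "k = h"
    proof (rule extensionalityI[of _ "carrier ?T"])
      fix t assume t: "t \<in> carrier ?T"
      have klin: "linear_map K ?T P k" using k by blast
      have kh: "k (tensor K M N x y) = h (tensor K M N x y)" if "x \<in> carrier M" "y \<in> carrier N" for x y
        using k hf that by simp
      show "k t = h t" by (rule tensor_unique[OF M N klin lin kh t])
    qed (use k hext in blast)+
  qed
qed

text \<open>The linear map on \<open>M \<otimes> N\<close> induced by a bilinear map; it exists and is unique by \<open>tensor_universal\<close>.\<close>

definition tensor_lift ::
  "('k, 'r) ring_scheme \<Rightarrow> ('k, 'a, 'm) module_scheme \<Rightarrow> ('k, 'b, 'n) module_scheme
     \<Rightarrow> ('k, 'c, 'p) module_scheme \<Rightarrow> ('a \<Rightarrow> 'b \<Rightarrow> 'c) \<Rightarrow> ('a \<times> 'b \<Rightarrow> 'k) set \<Rightarrow> 'c" where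
  "tensor_lift K M N P f =
     (THE h. h \<in> extensional (carrier (tensor_space K M N)) \<and>
             linear_map K (tensor_space K M N) P h \<and>
             (\<forall>x\<in>carrier M. \<forall>y\<in>carrier N. h (tensor K M N x y) = f x y))"

definition tensor_map ::
  "('k, 'r) ring_scheme \<Rightarrow> ('k, 'a, 'm) module_scheme \<Rightarrow> ('k, 'b, 'n) module_scheme
     \<Rightarrow> ('k, 'c, 'p) module_scheme \<Rightarrow> ('k, 'd, 'q) module_scheme
     \<Rightarrow> ('a \<Rightarrow> 'c) \<Rightarrow> ('b \<Rightarrow> 'd) \<Rightarrow> ('a \<times> 'b \<Rightarrow> 'k) set \<Rightarrow> ('c \<times> 'd \<Rightarrow> 'k) set" where
  "tensor_map K M N P Q f g =
     tensor_lift K M N (tensor_space K P Q) (\<lambda>x y. tensor K P Q (f x) (g y))"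

definition tensor_flip ::
  "('k, 'r) ring_scheme \<Rightarrow> ('k, 'a, 'm) module_scheme \<Rightarrow> ('k, 'b, 'n) module_scheme
     \<Rightarrow> ('a \<times> 'b \<Rightarrow> 'k) set \<Rightarrow> ('b \<times> 'a \<Rightarrow> 'k) set" where
  "tensor_flip K M N = tensor_lift K M N (tensor_space K N M) (\<lambda>x y. tensor K N M y x)"

text \<open>
  Threefold tensor products are bracketed to the left, \<open>(M \<otimes> N) \<otimes> P\<close>. The canonical isomorphism
  below, \<open>x \<otimes> (y \<otimes> z) \<mapsto> (x \<otimes> y) \<otimes> z\<close>, is suppressed in the usual notation.
\<close>

definition tensor_assoc ::
  "('k, 'r) ring_scheme \<Rightarrow> ('k, 'a, 'm) module_scheme \<Rightarrow> ('k, 'b, 'n) module_scheme \<Rightarrow> ('k, 'c, 'p) module_scheme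
     \<Rightarrow> ('a \<times> ('b \<times> 'c \<Rightarrow> 'k) set \<Rightarrow> 'k) set \<Rightarrow> (('a \<times> 'b \<Rightarrow> 'k) set \<times> 'c \<Rightarrow> 'k) set" where
  "tensor_assoc K M N P =
     tensor_lift K M (tensor_space K N P) (tensor_space K (tensor_space K M N) P)
       (\<lambda>x. tensor_lift K N P (tensor_space K (tensor_space K M N) P)
         (\<lambda>y z. tensor K (tensor_space K M N) P (tensor K M N x y) z))"

text \<open>The cyclic permutation \<open>\<sigma> (x1 \<otimes> x2 \<otimes> x3) = x3 \<otimes> x1 \<otimes> x2\<close>.\<close>

definition tensor_cycle ::
  "('k, 'r) ring_scheme \<Rightarrow> ('k, 'a, 'm) module_scheme
     \<Rightarrow> (('a \<times> 'a \<Rightarrow> 'k) set \<times> 'a \<Rightarrow> 'k) set \<Rightarrow> (('a \<times> 'a \<Rightarrow> 'k) set \<times> 'a \<Rightarrow> 'k) set" where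
  "tensor_cycle K A =
     tensor_lift K (tensor_space K A A) A (tensor_space K (tensor_space K A A) A)
       (\<lambda>t x3. tensor_lift K A A (tensor_space K (tensor_space K A A) A)
         (\<lambda>x1 x2. tensor K (tensor_space K A A) A (tensor K A A x3 x1) x2) t)"


section \<open>Hom-Poisson coalgebras and their comodules\<close>

definition hom_coassociative_coalgebra ::
  "('k, 'r) ring_scheme \<Rightarrow> ('k, 'a, 'm) module_scheme
     \<Rightarrow> ('a \<Rightarrow> ('a \<times> 'a \<Rightarrow> 'k) set) \<Rightarrow> ('a \<Rightarrow> 'a) \<Rightarrow> bool" where
  "hom_coassociative_coalgebra K A \<delta> \<alpha> \<longleftrightarrow>
     linear_map K A (tensor_space K A A) \<delta> \<and>
     linear_map K A A \<alpha> \<and>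
     (\<forall>x\<in>carrier A. \<delta> (\<alpha> x) = tensor_map K A A A A \<alpha> \<alpha> (\<delta> x)) \<and>
     (\<forall>x\<in>carrier A.
        tensor_assoc K A A A (tensor_map K A A A (tensor_space K A A) \<alpha> \<delta> (\<delta> x)) =
        tensor_map K A A (tensor_space K A A) A \<delta> \<alpha> (\<delta> x))"

definition hom_lie_coalgebra ::
  "('k, 'r) ring_scheme \<Rightarrow> ('k, 'a, 'm) module_scheme
     \<Rightarrow> ('a \<Rightarrow> ('a \<times> 'a \<Rightarrow> 'k) set) \<Rightarrow> ('a \<Rightarrow> 'a) \<Rightarrow> bool" where
  "hom_lie_coalgebra K A \<gamma> \<alpha> \<longleftrightarrow>
     linear_map K A (tensor_space K A A) \<gamma> \<and>
     linear_map K A A \<alpha> \<and>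
     (\<forall>x\<in>carrier A. \<gamma> x = \<ominus>\<^bsub>tensor_space K A A\<^esub> tensor_flip K A A (\<gamma> x)) \<and>
     (\<forall>x\<in>carrier A. \<gamma> (\<alpha> x) = tensor_map K A A A A \<alpha> \<alpha> (\<gamma> x)) \<and>
     (\<forall>x\<in>carrier A.
        let T = tensor_space K (tensor_space K A A) A;
            t = tensor_assoc K A A A (tensor_map K A A A (tensor_space K A A) \<alpha> \<gamma> (\<gamma> x))
        in t \<oplus>\<^bsub>T\<^esub> tensor_cycle K A t \<oplus>\<^bsub>T\<^esub> tensor_cycle K A (tensor_cycle K A t) = \<zero>\<^bsub>T\<^esub>)"

definition cocommutative_hom_poisson_coalgebra ::
  "('k, 'r) ring_scheme \<Rightarrow> ('k, 'a, 'm) module_scheme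
     \<Rightarrow> ('a \<Rightarrow> ('a \<times> 'a \<Rightarrow> 'k) set) \<Rightarrow> ('a \<Rightarrow> ('a \<times> 'a \<Rightarrow> 'k) set) \<Rightarrow> ('a \<Rightarrow> 'a) \<Rightarrow> bool" where
  "cocommutative_hom_poisson_coalgebra K A \<delta> \<gamma> \<alpha> \<longleftrightarrow>
     hom_coassociative_coalgebra K A \<delta> \<alpha> \<and>
     (\<forall>x\<in>carrier A. \<delta> x = tensor_flip K A A (\<delta> x)) \<and>
     hom_lie_coalgebra K A \<gamma> \<alpha> \<and>
     (\<forall>x\<in>carrier A.
        tensor_assoc K A A A (tensor_map K A A A (tensor_space K A A) \<alpha> \<delta> (\<gamma> x)) =
        tensor_map K A A (tensor_space K A A) A \<gamma> \<alpha> (\<delta> x)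
        \<oplus>\<^bsub>tensor_space K (tensor_space K A A) A\<^esub>
        tensor_map K (tensor_space K A A) A (tensor_space K A A) A (tensor_flip K A A) id
          (tensor_assoc K A A A (tensor_map K A A A (tensor_space K A A) \<alpha> \<gamma> (\<delta> x))))"

definition hom_module ::
  "('k, 'r) ring_scheme \<Rightarrow> ('k, 'b, 'n) module_scheme \<Rightarrow> ('b \<Rightarrow> 'b) \<Rightarrow> bool" where
  "hom_module K M \<beta> \<longleftrightarrow> linear_map K M M \<beta>"

definition coassociative_comodule ::
  "('k, 'r) ring_scheme \<Rightarrow> ('k, 'a, 'm) module_scheme \<Rightarrow> ('a \<Rightarrow> ('a \<times> 'a \<Rightarrow> 'k) set) \<Rightarrow> ('a \<Rightarrow> 'a)
     \<Rightarrow> ('k, 'b, 'n) module_scheme \<Rightarrow> ('b \<Rightarrow> ('a \<times> 'b \<Rightarrow> 'k) set) \<Rightarrow> ('b \<Rightarrow> 'b) \<Rightarrow> bool" where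
  "coassociative_comodule K A \<delta> \<alpha> M \<Delta> \<beta> \<longleftrightarrow>
     linear_map K M (tensor_space K A M) \<Delta> \<and>
     (\<forall>m\<in>carrier M. \<Delta> (\<beta> m) = tensor_map K A M A M \<alpha> \<beta> (\<Delta> m)) \<and>
     (\<forall>m\<in>carrier M.
        tensor_assoc K A A M (tensor_map K A M A (tensor_space K A M) \<alpha> \<Delta> (\<Delta> m)) =
        tensor_map K A M (tensor_space K A A) M \<delta> \<beta> (\<Delta> m))"

definition lie_comodule ::
  "('k, 'r) ring_scheme \<Rightarrow> ('k, 'a, 'm) module_scheme \<Rightarrow> ('a \<Rightarrow> ('a \<times> 'a \<Rightarrow> 'k) set) \<Rightarrow> ('a \<Rightarrow> 'a)
     \<Rightarrow> ('k, 'b, 'n) module_scheme \<Rightarrow> ('b \<Rightarrow> ('a \<times> 'b \<Rightarrow> 'k) set) \<Rightarrow> ('b \<Rightarrow> 'b) \<Rightarrow> bool" where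
  "lie_comodule K A \<gamma> \<alpha> M \<Gamma> \<beta> \<longleftrightarrow>
     linear_map K M (tensor_space K A M) \<Gamma> \<and>
     (\<forall>m\<in>carrier M. \<Gamma> (\<beta> m) = tensor_map K A M A M \<alpha> \<beta> (\<Gamma> m)) \<and>
     (\<forall>m\<in>carrier M.
        let t = tensor_assoc K A A M (tensor_map K A M A (tensor_space K A M) \<alpha> \<Gamma> (\<Gamma> m))
        in tensor_map K A M (tensor_space K A A) M \<gamma> \<beta> (\<Gamma> m) =
           t \<ominus>\<^bsub>tensor_space K (tensor_space K A A) M\<^esub>
           tensor_map K (tensor_space K A A) M (tensor_space K A A) M (tensor_flip K A A) id t)"

definition hom_poisson_comodule ::
  "('k, 'r) ring_scheme \<Rightarrow> ('k, 'a, 'm) module_scheme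
     \<Rightarrow> ('a \<Rightarrow> ('a \<times> 'a \<Rightarrow> 'k) set) \<Rightarrow> ('a \<Rightarrow> ('a \<times> 'a \<Rightarrow> 'k) set) \<Rightarrow> ('a \<Rightarrow> 'a)
     \<Rightarrow> ('k, 'b, 'n) module_scheme
     \<Rightarrow> ('b \<Rightarrow> ('a \<times> 'b \<Rightarrow> 'k) set) \<Rightarrow> ('b \<Rightarrow> ('a \<times> 'b \<Rightarrow> 'k) set) \<Rightarrow> ('b \<Rightarrow> 'b) \<Rightarrow> bool" where
  "hom_poisson_comodule K A \<delta> \<gamma> \<alpha> M \<Delta> \<Gamma> \<beta> \<longleftrightarrow>
     hom_module K M \<beta> \<and>
     coassociative_comodule K A \<delta> \<alpha> M \<Delta> \<beta> \<and>
     lie_comodule K A \<gamma> \<alpha> M \<Gamma> \<beta> \<and>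
     (\<forall>m\<in>carrier M.
        let T = tensor_space K (tensor_space K A A) M;
            swap = tensor_map K (tensor_space K A A) M (tensor_space K A A) M (tensor_flip K A A) id;
            \<alpha>\<Delta> = (\<lambda>t. tensor_assoc K A A M (tensor_map K A M A (tensor_space K A M) \<alpha> \<Delta> t));
            \<alpha>\<Gamma> = (\<lambda>t. tensor_assoc K A A M (tensor_map K A M A (tensor_space K A M) \<alpha> \<Gamma> t));
            \<gamma>\<beta> = tensor_map K A M (tensor_space K A A) M \<gamma> \<beta>;
            \<delta>\<beta> = tensor_map K A M (tensor_space K A A) M \<delta> \<beta>
        in \<alpha>\<Delta> (\<Gamma> m) = \<gamma>\<beta> (\<Delta> m) \<oplus>\<^bsub>T\<^esub> swap (\<alpha>\<Gamma> (\<Delta> m)) \<and>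
           \<delta>\<beta> (\<Gamma> m) = \<alpha>\<Gamma> (\<Delta> m) \<oplus>\<^bsub>T\<^esub> swap (\<alpha>\<Gamma> (\<Delta> m)))"

end

theory Submission
  imports Defs
begin

text \<open>
  Write \<open>a = \<alpha>\<^sup>2\<close>, an endomorphism of \<open>A\<close> commuting with \<open>\<alpha>\<close>, \<open>\<delta>\<close> and \<open>\<gamma>\<close>. Since
  \<open>(\<alpha> \<otimes> (a \<otimes> Id) F) (a \<otimes> Id) = (a \<otimes> a \<otimes> Id) (\<alpha> \<otimes> F)\<close>, \<open>(\<delta> \<otimes> \<beta>) (a \<otimes> Id) = (a \<otimes> a \<otimes> Id) (\<delta> \<otimes> \<beta>)\<close>
  and likewise for \<open>\<gamma>\<close>, and \<open>a \<otimes> a \<otimes> Id\<close> commutes with \<open>\<tau> \<otimes> Id\<close>, each axiom for the twisted maps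
  is the image under \<open>a \<otimes> a \<otimes> Id\<close> of the same axiom for the original maps.
\<close>

section \<open>Linear and bilinear maps\<close>

lemma linear_mapI:
  assumes "vectorspace K V" "vectorspace K W"
    and "\<And>v. v \<in> carrier V \<Longrightarrow> f v \<in> carrier W"
    and "\<And>u v. u \<in> carrier V \<Longrightarrow> v \<in> carrier V \<Longrightarrow> f (u \<oplus>\<^bsub>V\<^esub> v) = f u \<oplus>\<^bsub>W\<^esub> f v"
    and "\<And>c v. c \<in> carrier K \<Longrightarrow> v \<in> carrier V \<Longrightarrow> f (c \<odot>\<^bsub>V\<^esub> v) = c \<odot>\<^bsub>W\<^esub> f v"
  shows "linear_map K V W f"
  using assms
  by (intro linear_map.intro mod_hom.intro mod_hom_axioms.intro)
    (simp_all add: vectorspace_def module_hom_def)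

lemma linear_map_spaces:
  assumes "linear_map K V W f"
  shows "vectorspace K V" "vectorspace K W"
  using assms by (simp_all add: linear_map_def)

lemma linear_map_compose:
  assumes f: "linear_map K U V f" and g: "linear_map K V W g"
  shows "linear_map K U W (\<lambda>x. g (f x))"
proof -
  interpret f: linear_map K U V f by fact
  interpret g: linear_map K V W g by fact
  show ?thesis
    by (rule linear_mapI) (simp_all add: f.V.vectorspace_axioms g.W.vectorspace_axioms)
qed

lemma linear_map_id:
  assumes "vectorspace K V"
  shows "linear_map K V V id"
  by (rule linear_mapI[OF assms assms]) simp_all

lemma linear_map_funpow:
  assumes "linear_map K V V f"
  shows "linear_map K V V (f ^^ n)"
proof (induction n)
  case 0
  show ?case using linear_map_id[OF linear_map_spaces(1)[OF assms]] by (simp add: id_def)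
next
  case (Suc n)
  show ?case using linear_map_compose[OF Suc assms] by (simp add: comp_def)
qed

text \<open>Sums, and scalar multiples below, serve to compare lifts whose bilinear map depends
  linearly on a parameter, in \<open>tensor_lift_bilinear\<close>.\<close>

lemma linear_map_add:
  assumes f: "linear_map K V W f" and g: "linear_map K V W g"
  shows "linear_map K V W (\<lambda>x. f x \<oplus>\<^bsub>W\<^esub> g x)"
proof -
  note sp = linear_map_spaces[OF f]
  interpret W: vectorspace K W by (rule sp)
  note simps = linear_map.T_im[OF f] linear_map.T_im[OF g] linear_map.T_add[OF f] linear_map.T_add[OF g]
    linear_map.T_smult[OF f] linear_map.T_smult[OF g]
  show ?thesis
    by (rule linear_mapI[OF sp])
      (simp_all add: simps W.M.a_assoc W.M.a_comm W.M.a_lcomm W.smult_r_distr)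
qed

lemma linear_map_smult:
  assumes f: "linear_map K V W f" and c: "c \<in> carrier K"
  shows "linear_map K V W (\<lambda>x. c \<odot>\<^bsub>W\<^esub> f x)"
proof -
  note sp = linear_map_spaces[OF f]
  interpret W: vectorspace K W by (rule sp)
  show ?thesis
  proof (rule linear_mapI[OF sp])
    fix d x assume d: "d \<in> carrier K" and x: "x \<in> carrier V"
    note fx = linear_map.T_im[OF f x]
    \<comment> \<open>The scalars \<open>c\<close> and \<open>d\<close> change places by
      commutativity of \<open>K\<close>.\<close>
    show "c \<odot>\<^bsub>W\<^esub> f (d \<odot>\<^bsub>V\<^esub> x) = d \<odot>\<^bsub>W\<^esub> (c \<odot>\<^bsub>W\<^esub> f x)"
      unfolding linear_map.T_smult[OF f d x] W.smult_assoc1[OF c d fx, symmetric]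
        W.smult_assoc1[OF d c fx, symmetric] W.R.m_comm[OF c d] ..
  qed (simp_all add: c linear_map.T_im[OF f] linear_map.T_add[OF f] W.smult_r_distr)
qed

text \<open>With one argument fixed, each partial map is a composition of two linear maps.\<close>

lemma bilinear_map_compose:
  assumes B: "bilinear_map K P Q T B" and f: "linear_map K M P f" and g: "linear_map K N Q g"
  shows "bilinear_map K M N T (\<lambda>x y. B (f x) (g y))"
  unfolding bilinear_map_def
proof (intro conjI ballI)
  fix x assume "x \<in> carrier M"
  then have "f x \<in> carrier P" by (rule linear_map.T_im[OF f])
  then have "linear_map K Q T (B (f x))" using B by (simp add: bilinear_map_def)
  then show "linear_map K N T (\<lambda>y. B (f x) (g y))" by (rule linear_map_compose[OF g])
next
  fix y assume "y \<in> carrier N"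
  then have "g y \<in> carrier Q" by (rule linear_map.T_im[OF g])
  then have "linear_map K P T (\<lambda>x. B x (g y))" using B by (simp add: bilinear_map_def)
  then show "linear_map K M T (\<lambda>x. B (f x) (g y))" by (rule linear_map_compose[OF f])
qed

lemma bilinear_map_swap:
  "bilinear_map K M N P B \<Longrightarrow> bilinear_map K N M P (\<lambda>y x. B x y)"
  unfolding bilinear_map_def by (rule conjI[OF conjunct2 conjunct1])

section \<open>Functoriality of the tensor product\<close>

text \<open>The unique existence in \<open>tensor_universal\<close> gives the definite description
  its meaning. These two properties are all that is used about lifts below.\<close>

lemma tensor_lift:
  assumes M: "vectorspace K M" and N: "vectorspace K N" and P: "vectorspace K P"
    and f: "bilinear_map K M N P f"
  shows tensor_lift_linear: "linear_map K (tensor_space K M N) P (tensor_lift K M N P f)"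
    and tensor_lift_tensor: "x \<in> carrier M \<Longrightarrow> y \<in> carrier N \<Longrightarrow>
      tensor_lift K M N P f (tensor K M N x y) = f x y"
proof -
  note the = theI'[OF tensor_universal[OF assms], folded tensor_lift_def]
  show "linear_map K (tensor_space K M N) P (tensor_lift K M N P f)"
    by (rule the[THEN conjunct2, THEN conjunct1])
  show "tensor_lift K M N P f (tensor K M N x y) = f x y" if "x \<in> carrier M" "y \<in> carrier N"
    by (rule the[THEN conjunct2, THEN conjunct2, THEN bspec, THEN bspec, OF that])
qed

lemma tensor_map:
  assumes f: "linear_map K M P f" and g: "linear_map K N Q g"
  shows tensor_map_linear:
      "linear_map K (tensor_space K M N) (tensor_space K P Q) (tensor_map K M N P Q f g)"
    and tensor_map_tensor: "x \<in> carrier M \<Longrightarrow> y \<in> carrier N \<Longrightarrow>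
      tensor_map K M N P Q f g (tensor K M N x y) = tensor K P Q (f x) (g y)"
proof -
  note sp = linear_map_spaces[OF f] linear_map_spaces[OF g]
  have b: "bilinear_map K M N (tensor_space K P Q) (\<lambda>x y. tensor K P Q (f x) (g y))"
    by (rule bilinear_map_compose[OF tensor_bilinear[OF sp(2,4)] f g])
  note l = tensor_lift[OF sp(1,3) tensor_space_vectorspace[OF sp(2,4)] b]
  show "linear_map K (tensor_space K M N) (tensor_space K P Q) (tensor_map K M N P Q f g)"
    unfolding tensor_map_def by (rule l(1))
  show "tensor_map K M N P Q f g (tensor K M N x y) = tensor K P Q (f x) (g y)"
    if "x \<in> carrier M" "y \<in> carrier N"
    unfolding tensor_map_def by (rule l(2)[OF that])
qed

text \<open>Both sides are linear in \<open>t\<close> and agree on pure tensors, where the two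
  squares commute factor by factor. This form of bifunctoriality lets the two paths pass through
  different intermediate spaces, and it asks for commutation only on the carriers, since the maps
  are arbitrary outside them.\<close>

lemma tensor_map_square:
  assumes f: "linear_map K M P f" and g: "linear_map K N Q g"
    and f': "linear_map K P R f'" and g': "linear_map K Q S g'"
    and h: "linear_map K M P' h" and k: "linear_map K N Q' k"
    and h': "linear_map K P' R h'" and k': "linear_map K Q' S k'"
    and fh: "\<And>x. x \<in> carrier M \<Longrightarrow> f' (f x) = h' (h x)"
    and gk: "\<And>y. y \<in> carrier N \<Longrightarrow> g' (g y) = k' (k y)"
    and t: "t \<in> carrier (tensor_space K M N)"
  shows "tensor_map K P Q R S f' g' (tensor_map K M N P Q f g t) =
    tensor_map K P' Q' R S h' k' (tensor_map K M N P' Q' h k t)"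
proof (rule tensor_unique[OF linear_map_spaces(1)[OF f] linear_map_spaces(1)[OF g]
      linear_map_compose[OF tensor_map_linear[OF f g] tensor_map_linear[OF f' g']]
      linear_map_compose[OF tensor_map_linear[OF h k] tensor_map_linear[OF h' k']] _ t])
  fix x y assume xy: "x \<in> carrier M" "y \<in> carrier N"
  show "tensor_map K P Q R S f' g' (tensor_map K M N P Q f g (tensor K M N x y)) =
    tensor_map K P' Q' R S h' k' (tensor_map K M N P' Q' h k (tensor K M N x y))"
    using xy by (simp add: tensor_map_tensor f g f' g' h k h' k' linear_map.T_im[OF f] linear_map.T_im[OF g]
        linear_map.T_im[OF h] linear_map.T_im[OF k] fh gk)
qed

lemma tensor_flip:
  assumes M: "vectorspace K M" and N: "vectorspace K N"
  shows tensor_flip_linear: "linear_map K (tensor_space K M N) (tensor_space K N M) (tensor_flip K M N)"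
    and tensor_flip_tensor: "x \<in> carrier M \<Longrightarrow> y \<in> carrier N \<Longrightarrow>
      tensor_flip K M N (tensor K M N x y) = tensor K N M y x"
proof -
  note l = tensor_lift[OF M N tensor_space_vectorspace[OF N M] bilinear_map_swap[OF tensor_bilinear[OF N M]]]
  show "linear_map K (tensor_space K M N) (tensor_space K N M) (tensor_flip K M N)"
    unfolding tensor_flip_def by (rule l(1))
  show "tensor_flip K M N (tensor K M N x y) = tensor K N M y x"
    if "x \<in> carrier M" "y \<in> carrier N"
    unfolding tensor_flip_def by (rule l(2)[OF that])
qed

text \<open>Both composites send \<open>x\<close> \<otimes> \<open>y\<close> to \<open>g y\<close>
  \<otimes> \<open>f x\<close>, and linear maps that agree on pure tensors are equal.\<close>

lemma tensor_flip_natural: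
  assumes f: "linear_map K M P f" and g: "linear_map K N Q g"
    and t: "t \<in> carrier (tensor_space K M N)"
  shows "tensor_flip K P Q (tensor_map K M N P Q f g t) = tensor_map K N M Q P g f (tensor_flip K M N t)"
proof -
  note sp = linear_map_spaces[OF f] linear_map_spaces[OF g]
  note flip = tensor_flip_linear[OF sp(1,3)] tensor_flip_linear[OF sp(2,4)]
  show ?thesis
  proof (rule tensor_unique[OF sp(1,3) linear_map_compose[OF tensor_map_linear[OF f g] flip(2)]
        linear_map_compose[OF flip(1) tensor_map_linear[OF g f]] _ t])
    fix x y assume "x \<in> carrier M" "y \<in> carrier N"
    then show "tensor_flip K P Q (tensor_map K M N P Q f g (tensor K M N x y)) =
      tensor_map K N M Q P g f (tensor_flip K M N (tensor K M N x y))"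
      by (simp add: tensor_map_tensor f g tensor_flip_tensor sp linear_map.T_im[OF f] linear_map.T_im[OF g])
  qed
qed

section \<open>The associativity isomorphism and its naturality\<close>

text \<open>This justifies nesting one lift inside another, as in \<open>tensor_assoc\<close>: the
  inner lift must depend linearly on the outer variable \<open>x\<close>. For pure tensors this is
  the hypothesis \<open>l\<close>; it extends to every \<open>t\<close> by uniqueness of linear maps
  on the tensor product.\<close>

lemma tensor_lift_bilinear:
  assumes M: "vectorspace K M" and N: "vectorspace K N" and P: "vectorspace K P"
    and b: "\<And>x. x \<in> carrier L \<Longrightarrow> bilinear_map K M N P (B x)"
    and l: "\<And>y z. y \<in> carrier M \<Longrightarrow> z \<in> carrier N \<Longrightarrow> linear_map K L P (\<lambda>x. B x y z)"
    and L: "vectorspace K L"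
  shows "bilinear_map K L (tensor_space K M N) P (\<lambda>x. tensor_lift K M N P (B x))"
  unfolding bilinear_map_def
proof (intro conjI ballI)
  note lift = tensor_lift[OF M N P b]
  interpret L: vectorspace K L by fact
  show "linear_map K (tensor_space K M N) P (tensor_lift K M N P (B x))" if "x \<in> carrier L" for x
    by (rule lift(1)[OF that])
  fix t assume t: "t \<in> carrier (tensor_space K M N)"
  show "linear_map K L P (\<lambda>x. tensor_lift K M N P (B x) t)"
  proof (rule linear_mapI[OF L P])
    show "tensor_lift K M N P (B x) t \<in> carrier P" if "x \<in> carrier L" for x
      by (rule linear_map.T_im[OF lift(1)[OF that] t])
    show "tensor_lift K M N P (B (x \<oplus>\<^bsub>L\<^esub> x')) t =
        tensor_lift K M N P (B x) t \<oplus>\<^bsub>P\<^esub> tensor_lift K M N P (B x') t"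
      if x: "x \<in> carrier L" "x' \<in> carrier L" for x x'
    \<comment> \<open>Here \<open>x\<close> and \<open>x'\<close> are fixed and both sides are
      regarded as linear maps of \<open>t\<close>.\<close>
    proof (rule tensor_unique[OF M N lift(1)[OF L.M.a_closed[OF x]] linear_map_add[OF lift(1)[OF x(1)] lift(1)[OF x(2)]] _ t])
      fix y z assume "y \<in> carrier M" "z \<in> carrier N"
      then show "tensor_lift K M N P (B (x \<oplus>\<^bsub>L\<^esub> x')) (tensor K M N y z) =
        tensor_lift K M N P (B x) (tensor K M N y z) \<oplus>\<^bsub>P\<^esub> tensor_lift K M N P (B x') (tensor K M N y z)"
        using x by (simp add: lift(2) linear_map.T_add[OF l])
    qed
    show "tensor_lift K M N P (B (c \<odot>\<^bsub>L\<^esub> x)) t = c \<odot>\<^bsub>P\<^esub> tensor_lift K M N P (B x) t"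
      if c: "c \<in> carrier K" and x: "x \<in> carrier L" for c x
    proof (rule tensor_unique[OF M N lift(1)[OF L.smult_closed[OF c x]] linear_map_smult[OF lift(1)[OF x] c] _ t])
      fix y z assume "y \<in> carrier M" "z \<in> carrier N"
      then show "tensor_lift K M N P (B (c \<odot>\<^bsub>L\<^esub> x)) (tensor K M N y z) =
        c \<odot>\<^bsub>P\<^esub> tensor_lift K M N P (B x) (tensor K M N y z)"
        using x c by (simp add: lift(2) linear_map.T_smult[OF l])
    qed
  qed
qed

text \<open>The expression (\<open>x\<close> \<otimes> \<open>y\<close>) \<otimes> \<open>z\<close>
  is trilinear. Bilinearity in \<open>y\<close>, \<open>z\<close> yields the inner lift, linearity
  in \<open>x\<close> the outer one; evaluating first the outer and then the inner lift gives the
  formula on pure tensors.\<close>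

lemma tensor_assoc:
  assumes M: "vectorspace K M" and N: "vectorspace K N" and P: "vectorspace K P"
  shows tensor_assoc_linear:
      "linear_map K (tensor_space K M (tensor_space K N P)) (tensor_space K (tensor_space K M N) P)
         (tensor_assoc K M N P)"
    and tensor_assoc_tensor: "x \<in> carrier M \<Longrightarrow> y \<in> carrier N \<Longrightarrow> z \<in> carrier P \<Longrightarrow>
      tensor_assoc K M N P (tensor K M (tensor_space K N P) x (tensor K N P y z)) =
      tensor K (tensor_space K M N) P (tensor K M N x y) z"
proof -
  let ?MN = "tensor_space K M N"
  let ?T = "tensor_space K ?MN P"
  let ?B = "\<lambda>x y z. tensor K ?MN P (tensor K M N x y) z"
  have MN: "vectorspace K ?MN" by (rule tensor_space_vectorspace[OF M N])
  have T: "vectorspace K ?T" by (rule tensor_space_vectorspace[OF MN P])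
  have NP: "vectorspace K (tensor_space K N P)" by (rule tensor_space_vectorspace[OF N P])
  have MNb: "linear_map K N ?MN (tensor K M N x)" if "x \<in> carrier M" for x
    using tensor_bilinear[OF M N] that by (simp add: bilinear_map_def)
  have MNb': "linear_map K M ?MN (\<lambda>x. tensor K M N x y)" if "y \<in> carrier N" for y
    using tensor_bilinear[OF M N] that by (simp add: bilinear_map_def)
  have b: "bilinear_map K N P ?T (?B x)" if "x \<in> carrier M" for x
    using bilinear_map_compose[OF tensor_bilinear[OF MN P] MNb[OF that] linear_map_id[OF P]] by simp
  have l: "linear_map K M ?T (\<lambda>x. ?B x y z)" if "y \<in> carrier N" "z \<in> carrier P" for y z
    using linear_map_compose[OF MNb'[OF that(1)], of ?T "\<lambda>w. tensor K ?MN P w z"]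
      tensor_bilinear[OF MN P] that by (simp add: bilinear_map_def)
  note outer = tensor_lift[OF M NP T tensor_lift_bilinear[OF N P T b l M]]
  show "linear_map K (tensor_space K M (tensor_space K N P)) ?T (tensor_assoc K M N P)"
    unfolding tensor_assoc_def by (rule outer(1))
  show "tensor_assoc K M N P (tensor K M (tensor_space K N P) x (tensor K N P y z)) = ?B x y z"
    if "x \<in> carrier M" "y \<in> carrier N" "z \<in> carrier P"
    unfolding tensor_assoc_def
    using that by (simp add: outer(2) tensor_closed[OF N P] tensor_lift(2)[OF N P T b])
qed

text \<open>Uniqueness is used twice: on the outer product, and then, for each fixed
  \<open>x\<close>, on the inner one.\<close>

lemma tensor_unique_right:
  assumes M: "vectorspace K M" and N: "vectorspace K N" and P: "vectorspace K P"
    and g: "linear_map K (tensor_space K M (tensor_space K N P)) Q g"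
    and h: "linear_map K (tensor_space K M (tensor_space K N P)) Q h"
    and eq: "\<And>x y z. x \<in> carrier M \<Longrightarrow> y \<in> carrier N \<Longrightarrow> z \<in> carrier P \<Longrightarrow>
      g (tensor K M (tensor_space K N P) x (tensor K N P y z)) =
      h (tensor K M (tensor_space K N P) x (tensor K N P y z))"
    and t: "t \<in> carrier (tensor_space K M (tensor_space K N P))"
  shows "g t = h t"
proof (rule tensor_unique[OF M tensor_space_vectorspace[OF N P] g h _ t])
  fix x s assume x: "x \<in> carrier M" and s: "s \<in> carrier (tensor_space K N P)"
  \<comment> \<open>Since \<open>s\<close> \<mapsto> \<open>x\<close> \<otimes> \<open>s\<close> is
    linear, \<open>g\<close> and \<open>h\<close> composed with it are linear on the inner product
    and may be compared on \<open>y\<close> \<otimes> \<open>z\<close>.\<close>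
  have tx: "linear_map K (tensor_space K N P) (tensor_space K M (tensor_space K N P))
      (tensor K M (tensor_space K N P) x)"
    using tensor_bilinear[OF M tensor_space_vectorspace[OF N P]] x by (simp add: bilinear_map_def)
  show "g (tensor K M (tensor_space K N P) x s) = h (tensor K M (tensor_space K N P) x s)"
    by (rule tensor_unique[OF N P linear_map_compose[OF tx g] linear_map_compose[OF tx h] eq[OF x] s])
qed

text \<open>Both composites send \<open>x\<close> \<otimes> (\<open>y\<close> \<otimes>
  \<open>z\<close>) to (\<open>f x\<close> \<otimes> \<open>g y\<close>) \<otimes>
  \<open>h z\<close>.\<close>

lemma tensor_assoc_natural:
  assumes f: "linear_map K M M' f" and g: "linear_map K N N' g" and h: "linear_map K P P' h"
    and t: "t \<in> carrier (tensor_space K M (tensor_space K N P))"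
  shows "tensor_assoc K M' N' P' (tensor_map K M (tensor_space K N P) M' (tensor_space K N' P') f
      (tensor_map K N P N' P' g h) t) =
    tensor_map K (tensor_space K M N) P (tensor_space K M' N') P' (tensor_map K M N M' N' f g) h
      (tensor_assoc K M N P t)"
proof -
  note sp = linear_map_spaces[OF f] linear_map_spaces[OF g] linear_map_spaces[OF h]
  note im = linear_map.T_im[OF f] linear_map.T_im[OF g] linear_map.T_im[OF h]
  note gh = tensor_map_linear[OF g h] and fg = tensor_map_linear[OF f g]
  note as = tensor_assoc_linear[OF sp(1,3,5)] tensor_assoc_linear[OF sp(2,4,6)]
  show ?thesis
  proof (rule tensor_unique_right[OF sp(1,3,5)
        linear_map_compose[OF tensor_map_linear[OF f gh] as(2)]
        linear_map_compose[OF as(1) tensor_map_linear[OF fg h]] _ t])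
    fix x y z assume "x \<in> carrier M" "y \<in> carrier N" "z \<in> carrier P"
    then show "tensor_assoc K M' N' P' (tensor_map K M (tensor_space K N P) M' (tensor_space K N' P') f
        (tensor_map K N P N' P' g h) (tensor K M (tensor_space K N P) x (tensor K N P y z))) =
      tensor_map K (tensor_space K M N) P (tensor_space K M' N') P' (tensor_map K M N M' N' f g) h
        (tensor_assoc K M N P (tensor K M (tensor_space K N P) x (tensor K N P y z)))"
      by (simp add: tensor_map_tensor f g h gh fg tensor_assoc_tensor sp im tensor_closed)
  qed
qed

section \<open>Twisting a comodule by an endomorphism of the coalgebra\<close>

text \<open>One factor \<open>a\<close> comes from the twist of \<open>F\<close>, the other from the
  twist of the argument. The argument \<open>t\<close> is arbitrary because the mixed axioms apply
  one coaction to the values of the other.\<close>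

lemma tensor_map_twist_coaction:
  assumes a: "linear_map K A A a" and \<alpha>: "linear_map K A A \<alpha>"
    and F: "linear_map K M (tensor_space K A M) F"
    and comm: "\<And>x. x \<in> carrier A \<Longrightarrow> a (\<alpha> x) = \<alpha> (a x)"
    and t: "t \<in> carrier (tensor_space K A M)"
  shows "tensor_assoc K A A M (tensor_map K A M A (tensor_space K A M) \<alpha> (tensor_map K A M A M a id \<circ> F)
      (tensor_map K A M A M a id t)) =
    tensor_map K (tensor_space K A A) M (tensor_space K A A) M (tensor_map K A A A A a a) id
      (tensor_assoc K A A M (tensor_map K A M A (tensor_space K A M) \<alpha> F t))"
proof -
  note I = linear_map_id[OF linear_map_spaces(1)[OF F]]
  note aI = tensor_map_linear[OF a I]
  have aF: "linear_map K M (tensor_space K A M) (tensor_map K A M A M a id \<circ> F)"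
    using linear_map_compose[OF F aI] by (simp add: comp_def)
  \<comment> \<open>On the first factor this is \<open>comm\<close>; on the second, both paths are
    \<open>F\<close> followed by \<open>a\<close> \<otimes> \<open>id\<close>. Naturality then
    rebrackets \<open>a\<close> \<otimes> (\<open>a\<close> \<otimes> \<open>id\<close>) as
    (\<open>a\<close> \<otimes> \<open>a\<close>) \<otimes> \<open>id\<close>.\<close>
  have "tensor_map K A M A (tensor_space K A M) \<alpha> (tensor_map K A M A M a id \<circ> F) (tensor_map K A M A M a id t) =
    tensor_map K A (tensor_space K A M) A (tensor_space K A M) a (tensor_map K A M A M a id)
      (tensor_map K A M A (tensor_space K A M) \<alpha> F t)"
    by (rule tensor_map_square[OF a I \<alpha> aF \<alpha> F a aI _ _ t]) (simp_all add: comm)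
  then show ?thesis
    using tensor_assoc_natural[OF a a I linear_map.T_im[OF tensor_map_linear[OF \<alpha> F] t]] by simp
qed

text \<open>The single \<open>a\<close> on the coalgebra factor is doubled by \<open>comm\<close> as
  it passes through \<open>d\<close>. Here \<open>d\<close> stands for either \<delta> or
  \<gamma>.\<close>

lemma tensor_map_twist_comult:
  assumes a: "linear_map K A A a" and d: "linear_map K A (tensor_space K A A) d"
    and \<beta>: "linear_map K M M \<beta>"
    and comm: "\<And>x. x \<in> carrier A \<Longrightarrow> d (a x) = tensor_map K A A A A a a (d x)"
    and t: "t \<in> carrier (tensor_space K A M)"
  shows "tensor_map K A M (tensor_space K A A) M d \<beta> (tensor_map K A M A M a id t) =
    tensor_map K (tensor_space K A A) M (tensor_space K A A) M (tensor_map K A A A A a a) id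
      (tensor_map K A M (tensor_space K A A) M d \<beta> t)"
proof -
  note I = linear_map_id[OF linear_map_spaces(1)[OF \<beta>]]
  show ?thesis
    by (rule tensor_map_square[OF a I d \<beta> d \<beta> tensor_map_linear[OF a a] I _ _ t]) (simp_all add: comm)
qed

text \<open>Naturality of the flip, with the same map \<open>a\<close> on both factors.\<close>

lemma tensor_map_twist_flip:
  assumes a: "linear_map K A A a" and M: "vectorspace K M"
    and t: "t \<in> carrier (tensor_space K (tensor_space K A A) M)"
  shows "tensor_map K (tensor_space K A A) M (tensor_space K A A) M (tensor_flip K A A) id
      (tensor_map K (tensor_space K A A) M (tensor_space K A A) M (tensor_map K A A A A a a) id t) =
    tensor_map K (tensor_space K A A) M (tensor_space K A A) M (tensor_map K A A A A a a) id
      (tensor_map K (tensor_space K A A) M (tensor_space K A A) M (tensor_flip K A A) id t)"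
proof -
  note aa = tensor_map_linear[OF a a] and I = linear_map_id[OF M]
    and fl = tensor_flip_linear[OF linear_map_spaces(1)[OF a] linear_map_spaces(1)[OF a]]
  show ?thesis
    by (rule tensor_map_square[OF aa I fl I fl I aa I _ _ t]) (simp_all add: tensor_flip_natural[OF a a])
qed

section \<open>Powers of the structure map \<alpha>\<close>

lemma comult_funpow:
  assumes \<alpha>: "linear_map K A A \<alpha>" and d: "linear_map K A (tensor_space K A A) d"
    and comm: "\<And>x. x \<in> carrier A \<Longrightarrow> d (\<alpha> x) = tensor_map K A A A A \<alpha> \<alpha> (d x)"
    and x: "x \<in> carrier A"
  shows "d ((\<alpha> ^^ n) x) = tensor_map K A A A A (\<alpha> ^^ n) (\<alpha> ^^ n) (d x)"
proof (induction n)
  case 0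
  note A = linear_map_spaces(1)[OF \<alpha>]
  note I = linear_map_id[OF A] and dx = linear_map.T_im[OF d x]
  \<comment> \<open>The base case is functoriality for identities, checked on pure tensors.\<close>
  have "id (d x) = tensor_map K A A A A id id (d x)"
    by (rule tensor_unique[OF A A linear_map_id[OF tensor_space_vectorspace[OF A A]] tensor_map_linear[OF I I] _ dx])
      (simp add: tensor_map_tensor[OF I I])
  then show ?case by (simp add: id_def)
next
  case (Suc n)
  note p = linear_map_funpow[OF \<alpha>, of n] and p' = linear_map_funpow[OF \<alpha>, of "Suc n"]
    and I = linear_map_id[OF linear_map_spaces(1)[OF \<alpha>]] and dx = linear_map.T_im[OF d x]
  \<comment> \<open>The outermost \<alpha> is split off: \<open>comm\<close> applies at
    \<open>(\<alpha> ^^ n) x\<close>, and the induction hypothesis rewrites what remains.\<close>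
  have "d ((\<alpha> ^^ Suc n) x) = tensor_map K A A A A \<alpha> \<alpha> (tensor_map K A A A A (\<alpha> ^^ n) (\<alpha> ^^ n) (d x))"
    using comm[OF linear_map.T_im[OF p x]] Suc by simp
  also have "\<dots> = tensor_map K A A A A (\<alpha> ^^ Suc n) (\<alpha> ^^ Suc n) (d x)"
    by (rule tensor_unique[OF linear_map_spaces(1)[OF \<alpha>] linear_map_spaces(1)[OF \<alpha>]
          linear_map_compose[OF tensor_map_linear[OF p p] tensor_map_linear[OF \<alpha> \<alpha>]]
          tensor_map_linear[OF p' p'] _ dx])
      (simp add: tensor_map_tensor \<alpha> p p' linear_map.T_im[OF p] del: funpow.simps, simp)
  finally show ?case .
qed

section \<open>Transport of the comodule axioms along the twist\<close>

text \<open>Stated for any linear \<open>a\<close> that commutes with \<alpha> and is compatible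
  with \<delta> and \<gamma>, since these commutations are what moves the twist through the
  axioms.\<close>

lemma hom_poisson_comodule_twist:
  assumes \<alpha>: "linear_map K A A \<alpha>" and a: "linear_map K A A a"
    and \<delta>: "linear_map K A (tensor_space K A A) \<delta>" and \<gamma>: "linear_map K A (tensor_space K A A) \<gamma>"
    and a\<alpha>: "\<And>x. x \<in> carrier A \<Longrightarrow> a (\<alpha> x) = \<alpha> (a x)"
    and a\<delta>: "\<And>x. x \<in> carrier A \<Longrightarrow> \<delta> (a x) = tensor_map K A A A A a a (\<delta> x)"
    and a\<gamma>: "\<And>x. x \<in> carrier A \<Longrightarrow> \<gamma> (a x) = tensor_map K A A A A a a (\<gamma> x)"
    and comodule: "hom_poisson_comodule K A \<delta> \<gamma> \<alpha> M \<Delta> \<Gamma> \<beta>"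
  shows "hom_poisson_comodule K A \<delta> \<gamma> \<alpha> M
    (tensor_map K A M A M a id \<circ> \<Delta>) (tensor_map K A M A M a id \<circ> \<Gamma>) \<beta>"
proof -
  let ?AA = "tensor_space K A A"
  let ?T = "tensor_space K ?AA M"
  let ?tw = "tensor_map K A M A M a id"
  let ?Tw = "tensor_map K ?AA M ?AA M (tensor_map K A A A A a a) id"
  let ?swap = "tensor_map K ?AA M ?AA M (tensor_flip K A A) id"
  \<comment> \<open>The map \<alpha> \<otimes> \<open>F\<close>, rebracketed to the left;
    \<open>?Tw\<close> is \<open>a\<close> \<otimes> \<open>a\<close> \<otimes> \<open>id\<close> on
    the same threefold product.\<close>
  let ?co = "\<lambda>F t. tensor_assoc K A A M (tensor_map K A M A (tensor_space K A M) \<alpha> F t)"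
  have \<beta>: "linear_map K M M \<beta>" and \<Delta>: "linear_map K M (tensor_space K A M) \<Delta>"
    and \<Gamma>: "linear_map K M (tensor_space K A M) \<Gamma>"
    using comodule
    by (auto simp: hom_poisson_comodule_def hom_module_def coassociative_comodule_def lie_comodule_def)
  note A = linear_map_spaces(1)[OF \<alpha>] and M = linear_map_spaces(1)[OF \<beta>]
  note I = linear_map_id[OF M] and AA = tensor_space_vectorspace[OF A A]
  have Tw: "linear_map K ?T ?T ?Tw" by (rule tensor_map_linear[OF tensor_map_linear[OF a a] I])
  have swap: "linear_map K ?T ?T ?swap" by (rule tensor_map_linear[OF tensor_flip_linear[OF A A] I])
  have co: "?co F t \<in> carrier ?T"
    if "linear_map K M (tensor_space K A M) F" "t \<in> carrier (tensor_space K A M)" for F t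
    using linear_map.T_im[OF linear_map_compose[OF tensor_map_linear[OF \<alpha> that(1)] tensor_assoc_linear[OF A A M]] that(2)] .
  have comult: "tensor_map K A M ?AA M d \<beta> t \<in> carrier ?T"
    if "linear_map K A ?AA d" "t \<in> carrier (tensor_space K A M)" for d t
    using linear_map.T_im[OF tensor_map_linear[OF that(1) \<beta>] that(2)] .
  note closed = linear_map.T_im[OF \<Delta>] linear_map.T_im[OF \<Gamma>] co[OF \<Delta>] co[OF \<Gamma>] comult[OF \<delta>] comult[OF \<gamma>]
    linear_map.T_im[OF swap]
  note twist = tensor_map_twist_coaction[OF a \<alpha> \<Delta>, OF a\<alpha>] tensor_map_twist_coaction[OF a \<alpha> \<Gamma>, OF a\<alpha>]
    tensor_map_twist_comult[OF a \<delta> \<beta>, OF a\<delta>] tensor_map_twist_comult[OF a \<gamma> \<beta>, OF a\<gamma>]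
    tensor_map_twist_flip[OF a M]
  \<comment> \<open>This is the compatibility of the twist with \<beta>: \<open>a\<close> commutes
    with \<alpha> on the first factor, and \<open>id\<close> commutes with \<beta> on the
    second.\<close>
  have equivariant: "?tw (tensor_map K A M A M \<alpha> \<beta> t) = tensor_map K A M A M \<alpha> \<beta> (?tw t)"
    if "t \<in> carrier (tensor_space K A M)" for t
    by (rule tensor_map_square[OF \<alpha> \<beta> a I a I \<alpha> \<beta> _ _ that]) (simp_all add: a\<alpha>)
  have lin: "linear_map K M (tensor_space K A M) (?tw \<circ> F)" if "linear_map K M (tensor_space K A M) F" for F
    using linear_map_compose[OF that tensor_map_linear[OF a I]] by (simp add: comp_def)
  have axioms:
    "\<Delta> (\<beta> m) = tensor_map K A M A M \<alpha> \<beta> (\<Delta> m)"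
    "?co \<Delta> (\<Delta> m) = tensor_map K A M ?AA M \<delta> \<beta> (\<Delta> m)"
    "\<Gamma> (\<beta> m) = tensor_map K A M A M \<alpha> \<beta> (\<Gamma> m)"
    "tensor_map K A M ?AA M \<gamma> \<beta> (\<Gamma> m) = ?co \<Gamma> (\<Gamma> m) \<ominus>\<^bsub>?T\<^esub> ?swap (?co \<Gamma> (\<Gamma> m))"
    "?co \<Delta> (\<Gamma> m) = tensor_map K A M ?AA M \<gamma> \<beta> (\<Delta> m) \<oplus>\<^bsub>?T\<^esub> ?swap (?co \<Gamma> (\<Delta> m))"
    "tensor_map K A M ?AA M \<delta> \<beta> (\<Gamma> m) = ?co \<Gamma> (\<Delta> m) \<oplus>\<^bsub>?T\<^esub> ?swap (?co \<Gamma> (\<Delta> m))"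
    if "m \<in> carrier M" for m
    using comodule that
    unfolding hom_poisson_comodule_def coassociative_comodule_def lie_comodule_def Let_def by blast+
  show ?thesis
    unfolding hom_poisson_comodule_def hom_module_def coassociative_comodule_def lie_comodule_def Let_def
  proof (intro conjI ballI \<beta> lin[OF \<Delta>] lin[OF \<Gamma>])
    fix m assume m: "m \<in> carrier M"
    \<comment> \<open>The rules \<open>twist\<close> move \<open>?Tw\<close> to the outside of each
      term, linearity distributes it over sums and differences, and the original axioms identify
      what stands under it.\<close>
    note simps = comp_apply twist closed m equivariant axioms
      linear_map.T_minus[OF Tw] linear_map.T_add[OF Tw]
    show "(?tw \<circ> \<Delta>) (\<beta> m) = tensor_map K A M A M \<alpha> \<beta> ((?tw \<circ> \<Delta>) m)"
      by (simp only: simps)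
    show "?co (?tw \<circ> \<Delta>) ((?tw \<circ> \<Delta>) m) = tensor_map K A M ?AA M \<delta> \<beta> ((?tw \<circ> \<Delta>) m)"
      by (simp only: simps)
    show "(?tw \<circ> \<Gamma>) (\<beta> m) = tensor_map K A M A M \<alpha> \<beta> ((?tw \<circ> \<Gamma>) m)"
      by (simp only: simps)
    show "tensor_map K A M ?AA M \<gamma> \<beta> ((?tw \<circ> \<Gamma>) m) =
        ?co (?tw \<circ> \<Gamma>) ((?tw \<circ> \<Gamma>) m) \<ominus>\<^bsub>?T\<^esub> ?swap (?co (?tw \<circ> \<Gamma>) ((?tw \<circ> \<Gamma>) m))"
      by (simp only: simps)
    show "?co (?tw \<circ> \<Delta>) ((?tw \<circ> \<Gamma>) m) =
        tensor_map K A M ?AA M \<gamma> \<beta> ((?tw \<circ> \<Delta>) m) \<oplus>\<^bsub>?T\<^esub> ?swap (?co (?tw \<circ> \<Gamma>) ((?tw \<circ> \<Delta>) m))"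
      by (simp only: simps)
    show "tensor_map K A M ?AA M \<delta> \<beta> ((?tw \<circ> \<Gamma>) m) =
        ?co (?tw \<circ> \<Gamma>) ((?tw \<circ> \<Delta>) m) \<oplus>\<^bsub>?T\<^esub> ?swap (?co (?tw \<circ> \<Gamma>) ((?tw \<circ> \<Delta>) m))"
      by (simp only: simps)
  qed
qed

theorem theorem4p1:
  fixes K :: "('k, 'r) ring_scheme"
    and A :: "('k, 'a, 'm) module_scheme"
    and M :: "('k, 'b, 'n) module_scheme"
    and \<delta> \<gamma> :: "'a \<Rightarrow> ('a \<times> 'a \<Rightarrow> 'k) set"
    and \<alpha> :: "'a \<Rightarrow> 'a"
    and \<Delta> \<Gamma> :: "'b \<Rightarrow> ('a \<times> 'b \<Rightarrow> 'k) set"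
    and \<beta> :: "'b \<Rightarrow> 'b"
  assumes "field K"
    and char_0: "\<And>n::nat. n > 0 \<Longrightarrow> [n] \<cdot>\<^bsub>K\<^esub> \<one>\<^bsub>K\<^esub> \<noteq> \<zero>\<^bsub>K\<^esub>"
    and "cocommutative_hom_poisson_coalgebra K A \<delta> \<gamma> \<alpha>"
    and "hom_poisson_comodule K A \<delta> \<gamma> \<alpha> M \<Delta> \<Gamma> \<beta>"
  shows "hom_poisson_comodule K A \<delta> \<gamma> \<alpha> M
           (tensor_map K A M A M (\<alpha> ^^ 2) id \<circ> \<Delta>)
           (tensor_map K A M A M (\<alpha> ^^ 2) id \<circ> \<Gamma>)
           \<beta>"
proof -
  have \<alpha>: "linear_map K A A \<alpha>"
    and \<delta>: "linear_map K A (tensor_space K A A) \<delta>" and \<gamma>: "linear_map K A (tensor_space K A A) \<gamma>"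
    and \<alpha>\<delta>: "\<And>x. x \<in> carrier A \<Longrightarrow> \<delta> (\<alpha> x) = tensor_map K A A A A \<alpha> \<alpha> (\<delta> x)"
    and \<alpha>\<gamma>: "\<And>x. x \<in> carrier A \<Longrightarrow> \<gamma> (\<alpha> x) = tensor_map K A A A A \<alpha> \<alpha> (\<gamma> x)"
    using assms(3)
    by (auto simp: cocommutative_hom_poisson_coalgebra_def hom_coassociative_coalgebra_def hom_lie_coalgebra_def)
  \<comment> \<open>Take \<open>a\<close> to be \<open>\<alpha> ^^ 2\<close>; its compatibility with
    \<delta> and \<gamma> is that of \<alpha>, iterated.\<close>
  show ?thesis
  proof (rule hom_poisson_comodule_twist[OF \<alpha> linear_map_funpow[OF \<alpha>] \<delta> \<gamma> _ _ _ assms(4)])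
    fix x assume x: "x \<in> carrier A"
    show "(\<alpha> ^^ 2) (\<alpha> x) = \<alpha> ((\<alpha> ^^ 2) x)" by (simp add: funpow_swap1)
    show "\<delta> ((\<alpha> ^^ 2) x) = tensor_map K A A A A (\<alpha> ^^ 2) (\<alpha> ^^ 2) (\<delta> x)"
      by (rule comult_funpow[OF \<alpha> \<delta> _ x, OF \<alpha>\<delta>])
    show "\<gamma> ((\<alpha> ^^ 2) x) = tensor_map K A A A A (\<alpha> ^^ 2) (\<alpha> ^^ 2) (\<gamma> x)"
      by (rule comult_funpow[OF \<alpha> \<gamma> _ x, OF \<alpha>\<gamma>])
  qed
qed

end
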